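(* Consider a real planar polynomial differential system $\dot x=P(x,y),\ \dot y=Q(x,y)$ and assume that it has an invariant algebraic curve $f(x,y)=0$ with cofactor $k(x,y)$. For each $\alpha\in\mathbb{R}$ and each polynomial $g(x,y)$ define the polynomial $$N_{\alpha,g}(x,y)=\alpha k(x,y)g(x,y)+\frac{\partial g(x,y)}{\partial x}P(x,y)+\frac{\partial g(x,y)}{\partial y}Q(x,y).$$ If for some $\alpha$ and $g$ the polynomial $N_{\alpha,g}$ does not change sign and vanishes only on some algebraic curve that is not invariant by the flow, then the only limit cycles of the system (if any) are included in the invariant algebraic curve $f(x,y)=0$. Moreover, if for some $\alpha$ and $g$ one has $N_{\alpha,g}(x,y)\equiv0$, then $g(x,y)|f(x,y)|^{\alpha}$, if it is not piecewise constant, is a first integral of the system and the same conclusion holds, i.e. the only limit cycles of the system (if any) are included in $f(x,y)=0$.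
   Context: An algebraic curve $f(x,y)=0$, with $f$ an irreducible polynomial, is invariant for the system if $\frac{\partial f}{\partial x}P+\frac{\partial f}{\partial y}Q=kf$ for some polynomial $k$, called the cofactor of $f$. A limit cycle is an isolated periodic orbit. The function $g|f|^\alpha$ is considered on $\mathbb{R}^2\setminus\{f=0\}$. *)

theory Defs
  imports "HOL-Analysis.Analysis" "HOL-Computational_Algebra.Computational_Algebra"
begin

text \<open>
  A real polynomial in the two variables x and y is an element of R[x][y]: the outer
  indeterminate is y and the coefficients are polynomials in x.
\<close>

type_synonym poly2 = "real poly poly"

definition eval2 :: "poly2 \<Rightarrow> real \<times> real \<Rightarrow> real" where
  "eval2 p z = poly (poly p [:snd z:]) (fst z)"

definition pdx :: "poly2 \<Rightarrow> poly2" where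
  "pdx p = map_poly pderiv p"

definition pdy :: "poly2 \<Rightarrow> poly2" where
  "pdy p = pderiv p"

lemma eval2_pdx:
  "((\<lambda>x. eval2 p (x, y)) has_real_derivative eval2 (pdx p) (x, y)) (at x)"
proof -
  have "((\<lambda>x. eval2 p (x, y)) has_real_derivative poly (pderiv (poly p [:y:])) x) (at x)"
    by (simp add: eval2_def poly_DERIV)
  moreover have "pderiv (poly p [:y:]) = poly (map_poly pderiv p) [:y:]"
    by (induction p) (simp_all add: map_poly_pCons pderiv_add pderiv_mult pderiv_pCons pderiv_smult)
  ultimately show ?thesis
    by (simp add: eval2_def pdx_def)
qed

lemma eval2_pdy:
  "((\<lambda>y. eval2 p (x, y)) has_real_derivative eval2 (pdy p) (x, y)) (at y)"
proof (induction p)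
  case 0
  then show ?case by (simp add: eval2_def pdy_def)
next
  case (pCons a p)
  then show ?case
    by (auto simp: eval2_def pdy_def pderiv_pCons algebra_simps intro!: derivative_eq_intros)
qed

definition zero_set :: "poly2 \<Rightarrow> (real \<times> real) set" where
  "zero_set p = {z. eval2 p z = 0}"

definition vfield :: "poly2 \<Rightarrow> poly2 \<Rightarrow> real \<times> real \<Rightarrow> real \<times> real" where
  "vfield P Q z = (eval2 P z, eval2 Q z)"

definition solution_on ::
  "poly2 \<Rightarrow> poly2 \<Rightarrow> real set \<Rightarrow> (real \<Rightarrow> real \<times> real) \<Rightarrow> bool" where
  "solution_on P Q I \<phi> \<longleftrightarrow>
     (\<forall>t\<in>I. (\<phi> has_vector_derivative vfield P Q (\<phi> t)) (at t within I))"

text \<open>Equilibria are not periodic orbits.\<close>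

definition periodic_orbit :: "poly2 \<Rightarrow> poly2 \<Rightarrow> (real \<times> real) set \<Rightarrow> bool" where
  "periodic_orbit P Q \<Gamma> \<longleftrightarrow>
     (\<exists>\<phi> T. solution_on P Q UNIV \<phi> \<and> T > 0 \<and> (\<forall>t. \<phi> (t + T) = \<phi> t) \<and>
            \<not> \<phi> constant_on UNIV \<and> \<Gamma> = range \<phi>)"

text \<open>Isolated: some neighbourhood of the orbit contains no other periodic orbit.\<close>

definition limit_cycle :: "poly2 \<Rightarrow> poly2 \<Rightarrow> (real \<times> real) set \<Rightarrow> bool" where
  "limit_cycle P Q \<Gamma> \<longleftrightarrow>
     periodic_orbit P Q \<Gamma> \<and>
     (\<exists>U. open U \<and> \<Gamma> \<subseteq> U \<and> (\<forall>\<Gamma>'. periodic_orbit P Q \<Gamma>' \<and> \<Gamma>' \<subseteq> U \<longrightarrow> \<Gamma>' = \<Gamma>))"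

definition invariant_curve :: "poly2 \<Rightarrow> poly2 \<Rightarrow> poly2 \<Rightarrow> poly2 \<Rightarrow> bool" where
  "invariant_curve P Q f k \<longleftrightarrow> irreducible f \<and> pdx f * P + pdy f * Q = k * f"

text \<open>
  The curve \<open>h = 0\<close> may be reducible. Non-invariance is required of each of its irreducible
  components: a curve having an invariant component and a non-invariant one is not invariant
  as a whole, but may still contain limit cycles. A nonzero constant \<open>h\<close> (the empty curve)
  is allowed, which covers polynomials without real zeros. For irreducible \<open>h\<close> this just says
  that \<open>h = 0\<close> is not an invariant algebraic curve.
\<close>

definition noninvariant_curve :: "poly2 \<Rightarrow> poly2 \<Rightarrow> poly2 \<Rightarrow> bool" where
  "noninvariant_curve P Q h \<longleftrightarrow>
     h \<noteq> 0 \<and> (\<forall>p. irreducible p \<and> p dvd h \<longrightarrow> \<not> (\<exists>k. invariant_curve P Q p k))"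

definition N_poly :: "poly2 \<Rightarrow> poly2 \<Rightarrow> poly2 \<Rightarrow> real \<Rightarrow> poly2 \<Rightarrow> poly2" where
  "N_poly P Q k \<alpha> g = [:[:\<alpha>:]:] * k * g + pdx g * P + pdy g * Q"

definition no_sign_change :: "poly2 \<Rightarrow> bool" where
  "no_sign_change p \<longleftrightarrow> (\<forall>z. eval2 p z \<ge> 0) \<or> (\<forall>z. eval2 p z \<le> 0)"

definition piecewise_constant_on ::
  "(real \<times> real) set \<Rightarrow> (real \<times> real \<Rightarrow> real) \<Rightarrow> bool" where
  "piecewise_constant_on U H \<longleftrightarrow> (\<forall>C\<in>components U. H constant_on C)"

text \<open>
  A first integral on \<open>U\<close> is a continuously differentiable function, not constant on any
  nonempty open subset of \<open>U\<close>, that is constant along every solution staying in \<open>U\<close>.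
\<close>

definition first_integral ::
  "poly2 \<Rightarrow> poly2 \<Rightarrow> (real \<times> real) set \<Rightarrow> (real \<times> real \<Rightarrow> real) \<Rightarrow> bool" where
  "first_integral P Q U H \<longleftrightarrow>
     open U \<and> U \<noteq> {} \<and>
     (\<exists>H' :: real \<times> real \<Rightarrow> (real \<times> real) \<Rightarrow>\<^sub>L real.
        continuous_on U H' \<and>
        (\<forall>z\<in>U. (H has_derivative blinfun_apply (H' z)) (at z))) \<and>
     (\<forall>V. open V \<and> V \<noteq> {} \<and> V \<subseteq> U \<longrightarrow> \<not> H constant_on V) \<and>
     (\<forall>I \<phi>. is_interval I \<and> solution_on P Q I \<phi> \<and> \<phi> ` I \<subseteq> U \<longrightarrow>
        (\<lambda>t. H (\<phi> t)) constant_on I)"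

end

theory Submission
  imports Defs "HOL-Computational_Algebra.Field_as_Ring"
begin

text \<open>
  Let \<open>H = g \<bar>f\<bar>\<^sup>\<alpha>\<close>. Off the curve \<open>f = 0\<close> the derivative of \<open>H\<close> along the flow is \<open>\<bar>f\<bar>\<^sup>\<alpha> N\<close>, and a
  periodic orbit that is not contained in the curve does not meet it at all, because \<open>f\<close> solves a
  linear equation along solutions. So let a periodic orbit off the curve be given.

  If \<open>N\<close> does not change sign, then \<open>H\<close> is monotone along the orbit, and, being periodic, constant.
  Therefore \<open>N\<close> vanishes on the orbit, which lies on the curve \<open>h = 0\<close>. For some time interval it
  lies on one irreducible component \<open>p = 0\<close> (\<open>irreducible_factor_on_interval\<close>). There \<open>p\<close> and
  \<open>p\<^sub>x P + p\<^sub>y Q\<close> have infinitely many common zeros, which by a weak form of Bezout's theorem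
  (\<open>irreducible_combination_without_y\<close>) forces \<open>p\<close> to divide \<open>p\<^sub>x P + p\<^sub>y Q\<close>: the component is
  invariant, a contradiction (\<open>no_periodic_orbit_off_curve\<close>). Thus in this case there are not even
  non-isolated periodic orbits off the curve.

  If \<open>N = 0\<close>, then \<open>H\<close> is constant along solutions. Its gradient is a non-vanishing function times
  a pair of polynomials; if \<open>H\<close> were constant on some open set, these polynomials would be zero and
  \<open>H\<close> would be constant on every component of the complement of the curve. So \<open>H\<close> is a first
  integral (\<open>darboux_first_integral\<close>). It remains to see that a periodic orbit \<open>\<Gamma>\<close> off the
  curve is not isolated. The gradient of \<open>H\<close> may vanish on \<open>\<Gamma>\<close>, so the level curves of \<open>H\<close> near
  \<open>\<Gamma>\<close> cannot be obtained from the implicit function theorem. Instead, restrict \<open>H\<close> to a line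
  transversal to \<open>\<Gamma>\<close> at a point \<open>p\<close>. The derivative of this restriction is again a
  non-vanishing function times a polynomial, so near \<open>p\<close> the restriction is constant or injective
  on either side of \<open>p\<close> (\<open>darboux_injective_on_half_sections\<close>). A solution starting near \<open>p\<close> at a
  point where \<open>H\<close> differs from \<open>H p\<close> follows \<open>\<Gamma>\<close> and crosses the transversal line three times, at
  points with the same value of \<open>H\<close>; two of them are on the same side of \<open>p\<close>, hence equal, and the
  solution is periodic (\<open>first_integral_limit_cycle_on_curve\<close>).

  The facts about differential equations used here are existence and uniqueness for globally
  Lipschitz fields, by the contraction principle and Gronwall's inequality, and their consequences
  for polynomial fields truncated outside a ball: solutions near \<open>\<Gamma>\<close> follow it for any given time
  (\<open>continuous_dependence\<close>), and a solution that closes up extends to a periodic one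
  (\<open>closed_solution_periodic_orbit\<close>).
\<close>

section \<open>Bivariate polynomials as functions\<close>

lemma eval2_0 [simp]: "eval2 0 z = 0"
  and eval2_add [simp]: "eval2 (p + q) z = eval2 p z + eval2 q z"
  and eval2_mult [simp]: "eval2 (p * q) z = eval2 p z * eval2 q z"
  and eval2_const [simp]: "eval2 [:a:] z = poly a (fst z)"
  and eval2_smult [simp]: "eval2 (smult a p) z = poly a (fst z) * eval2 p z"
  and eval2_pCons: "eval2 (pCons a p) z = poly a (fst z) + snd z * eval2 p z"
  by (simp_all add: eval2_def)

lemma pdx_pCons [simp]: "pdx (pCons a p) = pCons (pderiv a) (pdx p)"
  by (simp add: pdx_def map_poly_pCons)

lemma pdx_0 [simp]: "pdx 0 = 0" and pdy_0 [simp]: "pdy 0 = 0"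
  by (simp_all add: pdx_def pdy_def)

lemma eval2_has_derivative:
  "(eval2 p has_derivative (\<lambda>v. eval2 (pdx p) z * fst v + eval2 (pdy p) z * snd v)) (at z within S)"
proof (induction p)
  case 0
  show ?case by (simp add: eval2_def[abs_def])
next
  case (pCons a p)
  have "((\<lambda>w. poly a (fst w)) has_derivative (\<lambda>v. poly (pderiv a) (fst z) * fst v)) (at z within S)"
    using DERIV_compose_FDERIV[OF poly_DERIV bounded_linear_imp_has_derivative[OF bounded_linear_fst], of a]
    by (simp add: mult.commute)
  then have "((\<lambda>w. poly a (fst w) + snd w * eval2 p w) has_derivative
      (\<lambda>v. poly (pderiv a) (fst z) * fst v +
         (snd z * (eval2 (pdx p) z * fst v + eval2 (pdy p) z * snd v) + snd v * eval2 p z)))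
      (at z within S)"
    by (intro has_derivative_add has_derivative_mult pCons.IH has_derivative_snd has_derivative_ident)
  then show ?case
    by (simp add: eval2_pCons[abs_def] pdy_def pderiv_pCons algebra_simps)
qed

lemma continuous_on_eval2 [continuous_intros]:
  "continuous_on S F \<Longrightarrow> continuous_on S (\<lambda>t. eval2 p (F t))"
  by (rule continuous_on_compose2[of UNIV "eval2 p"])
     (auto intro!: has_derivative_continuous_on[OF eval2_has_derivative])

lemma poly2_eq_0_if_vanishes_on_open:
  assumes "open V" "V \<noteq> {}" "\<And>z. z \<in> V \<Longrightarrow> eval2 p z = 0"
  shows "p = 0"
proof -
  from assms obtain A B where AB: "open A" "open B" "A \<noteq> {}" "B \<noteq> {}" "A \<times> B \<subseteq> V"
    by (metis all_not_in_conv mem_Sigma_iff open_prod_elim prod.collapse)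
  then have inf: "infinite A" "infinite B"
    using finite_imp_not_open by blast+
  have "poly p [:y:] = 0" if "y \<in> B" for y
  proof (rule ccontr)
    assume "poly p [:y:] \<noteq> 0"
    then have "finite {x. poly (poly p [:y:]) x = 0}"
      by (rule poly_roots_finite)
    moreover have "A \<subseteq> {x. poly (poly p [:y:]) x = 0}"
      using AB that assms(3) by (fastforce simp: eval2_def)
    ultimately show False
      using inf finite_subset by blast
  qed
  then have "(\<lambda>y. [:y:]) ` B \<subseteq> {c. poly p c = 0}"
    by auto
  moreover have "infinite ((\<lambda>y. [:y:]) ` B)"
    using inf by (simp add: finite_image_iff inj_on_def)
  ultimately show ?thesis
    using poly_roots_finite finite_subset by blast
qed

text \<open>
  The restriction of a polynomial to a parametrised line is a polynomial in the parameter, so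
  one non-zero value leaves only finitely many zeros.
\<close>

lemma finite_zeros_on_line:
  assumes "eval2 w (a + r * c, b + r * d) \<noteq> 0"
  shows "finite {s. eval2 w (a + s * c, b + s * d) = 0}"
proof -
  have "\<exists>q. \<forall>s. poly q s = eval2 w (a + s * c, b + s * d)"
  proof (induction w)
    case 0
    show ?case by (intro exI[of _ 0]) simp
  next
    case (pCons e w)
    then obtain q where "\<forall>s. poly q s = eval2 w (a + s * c, b + s * d)" by blast
    then show ?case
      by (intro exI[of _ "pcompose e [:a, c:] + [:b, d:] * q"])
         (simp add: eval2_pCons poly_pcompose algebra_simps)
  qed
  then obtain q where q: "\<And>s. poly q s = eval2 w (a + s * c, b + s * d)" by blast
  with assms have "q \<noteq> 0" by (metis poly_0)
  then show ?thesis
    using poly_roots_finite[of q] by (simp add: q)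
qed

text \<open>
  Modulo \<open>x - a\<close> the polynomial \<open>p\<close> becomes the univariate polynomial \<open>p(a, y)\<close>; infinitely
  many roots make it vanish, i.e. \<open>x - a\<close> divides every coefficient of \<open>p\<close>.
\<close>

lemma vertical_line_dvd:
  assumes "infinite {y. eval2 p (a, y) = 0}"
  shows "[:[:- a, 1:]:] dvd p"
proof -
  have ev: "poly (map_poly (\<lambda>c. poly c a) p) y = eval2 p (a, y)" for y
    by (induction p) (simp_all add: eval2_pCons map_poly_pCons)
  have "map_poly (\<lambda>c. poly c a) p = 0"
    using assms poly_roots_finite[of "map_poly (\<lambda>c. poly c a) p"] by (auto simp: ev)
  then have "poly (coeff p n) a = 0" for n
    by (metis coeff_0 coeff_map_poly poly_0)
  then show ?thesis
    by (simp add: const_poly_dvd_iff poly_eq_0_iff_dvd)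
qed

text \<open>
  This is the weak form of Bezout's theorem behind the finiteness of the intersection of two
  curves: at a common zero of \<open>p\<close> and \<open>q\<close> the abscissa is a root of \<open>r\<close>. Take an element \<open>d\<close>
  of least degree in \<open>y\<close> among the non-zero elements of the ideal \<open>(p, q)\<close>.
  Pseudo-division by \<open>d\<close> shows that \<open>d\<close> divides \<open>p\<close> and \<open>q\<close> up to factors free of \<open>y\<close>. If \<open>d\<close>
  and \<open>p\<close> both involve \<open>y\<close>, then primality of \<open>p\<close> (Gauss' lemma) turns this into \<open>p dvd d\<close> and
  then \<open>p dvd q\<close>, which is excluded; so \<open>d\<close> or \<open>p\<close> itself is the combination sought.
\<close>

lemma irreducible_combination_without_y:
  fixes p q :: poly2
  assumes p: "irreducible p" and npq: "\<not> p dvd q"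
  obtains A B r where "A * p + B * q = [:r:]" "r \<noteq> 0"
proof -
  have prime: "prime_elem p"
    using p by (rule irreducible_imp_prime_elem)
  have p0: "p \<noteq> 0" using p by auto
  define I where "I = {d. \<exists>A B. d = A * p + B * q}"
  have I_comb: "u * d - v * e \<in> I" if de: "d \<in> I" "e \<in> I" for d e u v
  proof -
    from de obtain A B C D where "d = A * p + B * q" "e = C * p + D * q"
      unfolding I_def by blast
    then have "u * d - v * e = (u * A - v * C) * p + (u * B - v * D) * q"
      by (simp add: algebra_simps)
    then show ?thesis unfolding I_def by blast
  qed
  have pI: "p \<in> I" unfolding I_def by (auto intro: exI[of _ 1] exI[of _ 0])
  have qI: "q \<in> I" unfolding I_def
    by (rule CollectI, rule exI[of _ 0], rule exI[of _ 1]) simp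
  obtain d where d: "d \<in> I" "d \<noteq> 0" and min: "\<And>e. e \<in> I \<Longrightarrow> e \<noteq> 0 \<Longrightarrow> degree d \<le> degree e"
    using exists_least_iff[of "\<lambda>n. \<exists>d. d \<in> I \<and> d \<noteq> 0 \<and> degree d = n"] pI p0
    by (metis not_less)
  have mult: "\<exists>c s. c \<noteq> 0 \<and> smult c e = d * s" if e: "e \<in> I" for e
  proof -
    obtain s r where sr: "pseudo_divmod e d = (s, r)" by force
    let ?c = "coeff d (degree d) ^ (Suc (degree e) - degree d)"
    note pd = pseudo_divmod[OF d(2) sr]
    have "r = [:?c:] * e - s * d" using pd(1) by (simp add: algebra_simps)
    then have "r \<in> I" using I_comb[OF e d(1), of "[:?c:]" s] by simp
    then have "r = 0" using pd(2) min by fastforce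
    then show ?thesis using pd(1) d(2) by (intro exI[of _ ?c] exI[of _ s]) simp
  qed
  have deg0: "\<exists>r. r \<noteq> 0 \<and> [:r:] \<in> I"
  proof (cases "degree d = 0 \<or> degree p = 0")
    case True
    then show ?thesis using d pI p0 by (metis degree_eq_zeroE pCons_0_0)
  next
    case False
    obtain c s where cs: "c \<noteq> 0" "smult c p = d * s" using mult[OF pI] by blast
    obtain c' s' where cs': "c' \<noteq> 0" "smult c' q = d * s'" using mult[OF qI] by blast
    have not_const: "\<not> p dvd [:c:]" if "c \<noteq> 0" for c
      using False that by (metis dvd_imp_degree_le degree_pCons_0 le_zero_eq pCons_eq_0_iff)
    have "p dvd d * s" using cs(2) by (metis dvd_smult dvd_refl)
    then consider "p dvd d" | "p dvd s" using prime prime_elem_dvd_multD by blast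
    then have "p dvd d"
    proof cases
      case 2
      then obtain s'' where "s = p * s''" by (elim dvdE)
      then have "p * [:c:] = p * (d * s'')" using cs(2) by (simp add: algebra_simps)
      then have "[:c:] = d * s''" using p0 by (simp only: mult_cancel_left) simp
      then have "degree d = 0"
        using cs(1) by (metis degree_pCons_0 dvdI dvd_imp_degree_le le_zero_eq pCons_eq_0_iff)
      with False show ?thesis by blast
    qed
    then have "p dvd [:c':] * q" using cs'(2) by simp
    then have "p dvd q" using prime prime_elem_dvd_multD not_const[OF cs'(1)] by blast
    with npq show ?thesis by blast
  qed
  then obtain r A B where "r \<noteq> 0" "[:r:] = A * p + B * q"
    unfolding I_def by blast
  then show thesis using that[of A B r] by simp
qed

text \<open>
  A solution lying on a possibly reducible curve stays on one irreducible component for some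
  time, by induction on the prime factorisation.
\<close>

lemma irreducible_factor_on_interval:
  fixes a b :: real
  assumes h: "h \<noteq> 0" "\<And>t. t \<in> {a..b} \<Longrightarrow> eval2 h (\<phi> t) = 0"
    and cont: "continuous_on {a..b} \<phi>" and "a < b"
  obtains p c d where "irreducible p" "p dvd h" "a \<le> c" "c < d" "d \<le> b"
    "\<And>t. t \<in> {c..d} \<Longrightarrow> eval2 p (\<phi> t) = 0"
proof -
  have "\<exists>p c d. irreducible p \<and> p dvd h \<and> a \<le> c \<and> c < d \<and> d \<le> b \<and> (\<forall>t\<in>{c..d}. eval2 p (\<phi> t) = 0)"
    using h cont \<open>a < b\<close>
  proof (induction h arbitrary: a b rule: prime_divisors_induct)
    case zero
    then show ?case by simp
  next
    case (unit u)
    then obtain v where "1 = u * v" by (elim dvdE)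
    then have "eval2 u (\<phi> a) * eval2 v (\<phi> a) = eval2 1 (\<phi> a)"
      by (simp only: eval2_mult[symmetric])
    moreover have "eval2 u (\<phi> a) = 0"
      by (rule unit.prems(2)) (use unit.prems(4) in auto)
    ultimately show ?case by (simp add: eval2_def)
  next
    case (factor p h)
    have p: "irreducible p"
      using factor.hyps by (simp add: prime_elem_imp_irreducible prime_imp_prime_elem)
    show ?case
    proof (cases "\<forall>t\<in>{a..b}. eval2 p (\<phi> t) = 0")
      case True
      then show ?thesis using p factor.prems by (metis dvd_triv_left order_refl)
    next
      case False
      \<comment> \<open>Off the curve p = 0 the other factor has to vanish, and this is an open condition on time.\<close>
      have "continuous_on {a..b} (\<lambda>t. eval2 p (\<phi> t))"
        using factor.prems by (intro continuous_intros)
      from False obtain t0 where t0: "t0 \<in> {a..b}" "eval2 p (\<phi> t0) \<noteq> 0" by blast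
      obtain e where e: "e > 0" "\<And>t. t \<in> {a..b} \<Longrightarrow> dist t t0 < e \<Longrightarrow> eval2 p (\<phi> t) \<noteq> 0"
      proof -
        have "\<exists>e>0. \<forall>t\<in>{a..b}. dist t t0 < e \<longrightarrow> dist (eval2 p (\<phi> t)) (eval2 p (\<phi> t0)) < \<bar>eval2 p (\<phi> t0)\<bar>"
          using \<open>continuous_on {a..b} (\<lambda>t. eval2 p (\<phi> t))\<close> t0
          unfolding continuous_on_iff by simp
        then show ?thesis using that by (force simp: dist_real_def)
      qed
      define c where "c = max a (t0 - e / 2)"
      define d where "d = min b (t0 + e / 2)"
      have cd: "a \<le> c" "c < d" "d \<le> b" "\<And>t. t \<in> {c..d} \<Longrightarrow> dist t t0 < e"
        using t0 e(1) \<open>a < b\<close> by (auto simp: c_def d_def dist_real_def)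
      have "eval2 h (\<phi> t) = 0" if "t \<in> {c..d}" for t
        using factor.prems(2)[of t] e(2)[of t] cd that by auto
      then obtain p' c' d' where "irreducible p'" "p' dvd h" "c \<le> c'" "c' < d'" "d' \<le> d"
          "\<forall>t\<in>{c'..d'}. eval2 p' (\<phi> t) = 0"
        using factor.IH[of c d] factor.prems(1) cd continuous_on_subset[OF factor.prems(3), of "{c..d}"]
        by (auto simp del: atLeastAtMost_iff)
      then show ?thesis using cd by (meson dvd_mult order_trans)
    qed
  qed
  then show thesis using that by blast
qed

section \<open>Lipschitz differential equations\<close>

text \<open>
  Gronwall's inequality in differential form: \<open>\<parallel>u\<parallel>\<^sup>2 exp(-2L(t - a))\<close> is nonincreasing. Squaring
  the norm avoids its lack of differentiability at zero.
\<close>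

lemma gronwall_norm:
  fixes u :: "real \<Rightarrow> 'a::real_inner"
  assumes u: "\<And>t. t \<in> {a..b} \<Longrightarrow> (u has_vector_derivative u' t) (at t within {a..b})"
    and bound: "\<And>t. t \<in> {a..b} \<Longrightarrow> norm (u' t) \<le> L * norm (u t)"
    and t: "t \<in> {a..b}"
  shows "norm (u t) \<le> norm (u a) * exp (L * (t - a))"
proof -
  let ?v = "\<lambda>s. (u s \<bullet> u s) * exp (- 2 * L * (s - a))"
  have v: "(?v has_real_derivative
      2 * (u s \<bullet> u' s - L * (u s \<bullet> u s)) * exp (- 2 * L * (s - a))) (at s within {a..b})"
    if "s \<in> {a..b}" for s
  proof -
    have "((\<lambda>s. u s \<bullet> u s) has_derivative (\<lambda>h. u s \<bullet> (h *\<^sub>R u' s) + (h *\<^sub>R u' s) \<bullet> u s)) (at s within {a..b})"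
      using u[OF that] unfolding has_vector_derivative_def by (intro has_derivative_inner)
    then have "((\<lambda>s. u s \<bullet> u s) has_real_derivative 2 * (u s \<bullet> u' s)) (at s within {a..b})"
      unfolding has_field_derivative_def
      by (rule has_derivative_eq_rhs) (simp add: fun_eq_iff inner_commute)
    then show ?thesis
      by (auto intro!: derivative_eq_intros simp: algebra_simps)
  qed
  have "?v t \<le> ?v a"
  proof (rule DERIV_nonpos_imp_decreasing_open[where f = ?v])
    show "a \<le> t" using t by simp
    have "continuous_on {a..b} ?v" using v by (rule DERIV_continuous_on)
    then show "continuous_on {a..t} ?v" by (rule continuous_on_subset) (use t in auto)
    fix s assume s: "a < s" "s < t"
    then have sab: "s \<in> {a..b}" using t by simp
    have "u s \<bullet> u' s \<le> norm (u s) * norm (u' s)" by (rule norm_cauchy_schwarz)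
    also have "\<dots> \<le> norm (u s) * (L * norm (u s))"
      using bound[OF sab] by (rule mult_left_mono) simp
    also have "\<dots> = L * (u s \<bullet> u s)"
      by (simp add: power2_norm_eq_inner[symmetric] power2_eq_square)
    finally have "2 * (u s \<bullet> u' s - L * (u s \<bullet> u s)) * exp (- 2 * L * (s - a)) \<le> 0"
      by (simp add: mult_nonpos_nonneg)
    moreover have "(?v has_real_derivative
        2 * (u s \<bullet> u' s - L * (u s \<bullet> u s)) * exp (- 2 * L * (s - a))) (at s)"
      using v[OF sab] s t at_within_Icc_at[of a s b] by simp
    ultimately show "\<exists>y. (?v has_real_derivative y) (at s) \<and> y \<le> 0"
      by blast
  qed
  then have le: "(u t \<bullet> u t) * exp (- 2 * L * (t - a)) \<le> u a \<bullet> u a"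
    by simp
  have "u t \<bullet> u t = (u t \<bullet> u t) * exp (- 2 * L * (t - a)) * exp (2 * L * (t - a))"
    by (simp add: mult.assoc exp_add[symmetric])
  also have "\<dots> \<le> (u a \<bullet> u a) * exp (2 * L * (t - a))"
    using le by (rule mult_right_mono) simp
  also have "exp (2 * L * (t - a)) = (exp (L * (t - a)))\<^sup>2"
    by (simp add: exp_double[symmetric] mult.assoc)
  finally have "(norm (u t))\<^sup>2 \<le> (norm (u a) * exp (L * (t - a)))\<^sup>2"
    by (simp add: power2_norm_eq_inner power_mult_distrib)
  then show ?thesis
    by (rule power2_le_imp_le) simp
qed

lemma lipschitz_solutions_dist:
  fixes x y :: "real \<Rightarrow> 'a::real_inner"
  assumes F: "L-lipschitz_on UNIV F"
    and x: "\<And>t. t \<in> {a..b} \<Longrightarrow> (x has_vector_derivative F (x t)) (at t within {a..b})"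
    and y: "\<And>t. t \<in> {a..b} \<Longrightarrow> (y has_vector_derivative F (y t)) (at t within {a..b})"
    and t: "t \<in> {a..b}"
  shows "norm (x t - y t) \<le> norm (x a - y a) * exp (L * (t - a))"
  by (rule gronwall_norm[where b = b and u' = "\<lambda>t. F (x t) - F (y t)"])
     (use F x y t in \<open>auto intro!: has_vector_derivative_diff lipschitz_on_normD\<close>)

lemma has_vector_derivative_time_shift:
  assumes "(y has_vector_derivative D) (at (t + c) within S)" "(\<lambda>t. t + c) ` S' \<subseteq> S"
  shows "((\<lambda>t. y (t + c)) has_vector_derivative D) (at t within S')"
proof -
  have "((\<lambda>t. t + c) has_vector_derivative 1) (at t within S')"
    by (auto intro!: derivative_eq_intros)
  from vector_diff_chain_within[OF this has_vector_derivative_within_subset[OF assms]]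
  show ?thesis by (simp add: o_def)
qed

text \<open>
  The Picard--Lindeloef theorem on the whole half line in one step. Writing the unknown solution
  as \<open>z + exp(c t) b(t)\<close> with \<open>b\<close> bounded, the Picard operator becomes a map of bounded continuous
  functions with Lipschitz constant \<open>L / c < 1\<close>, because the integral of \<open>exp(c s)\<close> only gains the
  factor \<open>1 / c\<close>. Clamping time at zero lets \<open>b\<close> be a function on all of the real line.
\<close>

lemma lipschitz_solution_exists:
  fixes F :: "'a::euclidean_space \<Rightarrow> 'a"
  assumes F: "L-lipschitz_on UNIV F"
  obtains x where "x 0 = z" "\<And>t. 0 \<le> t \<Longrightarrow> (x has_vector_derivative F (x t)) (at t within {0..})"
proof -
  have L0: "0 \<le> L" using F by (rule lipschitz_on_nonneg)
  have contF: "continuous_on UNIV F" using F by (rule lipschitz_on_continuous_on)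
  define c where "c = 2 * L + 1"
  have c: "c > 0" "L / c < 1" using L0 by (auto simp: c_def field_simps)
  define E where "E b s = z + exp (c * s) *\<^sub>R apply_bcontfun b s" for b s
  define J where "J b t = integral {0..t} (\<lambda>s. F (E b s))" for b t
  define K0 where "K0 b t = exp (- c * max 0 t) *\<^sub>R J b (max 0 t)" for b t
  have contE: "continuous_on S (\<lambda>s. F (E b s))" for b S
    unfolding E_def by (intro continuous_on_compose2[OF contF] continuous_intros) auto
  have J: "(J b has_vector_derivative F (E b t)) (at t within {0..})" if "0 \<le> t" for b t
  proof -
    have "(J b has_vector_derivative F (E b t)) (at t within {0..t + 1})"
      unfolding J_def using that by (intro integral_has_vector_derivative contE) auto
    moreover have "at t within {0..} = at t within {0..t + 1}"
      by (rule at_within_nhd[of t "{..<t + 1}"]) auto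
    ultimately show ?thesis by simp
  qed
  have contJ: "continuous_on {0..} (J b)" for b
    using J by (meson atLeast_iff continuous_on_eq_continuous_within has_vector_derivative_continuous)
  have J_dist: "norm (J b t - J b' t) \<le> exp (c * t) * (L / c * dist b b')" if t: "0 \<le> t" for b b' t
  proof -
    let ?g = "\<lambda>s. L * dist b b' * exp (c * s)"
    have "(?g has_integral (L / c * dist b b' * exp (c * t) - L / c * dist b b' * exp (c * 0))) {0..t}"
      using t c
      by (intro fundamental_theorem_of_calculus)
         (auto intro!: derivative_eq_intros simp flip: has_real_derivative_iff_has_vector_derivative)
    then have "(?g has_integral (L / c * dist b b' * (exp (c * t) - 1))) {0..t}"
      by (simp add: right_diff_distrib)
    then have g: "?g integrable_on {0..t}" "integral {0..t} ?g = L / c * dist b b' * (exp (c * t) - 1)"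
      by (rule has_integral_integrable, rule integral_unique)
    have "J b t - J b' t = integral {0..t} (\<lambda>s. F (E b s) - F (E b' s))"
      unfolding J_def by (intro integral_diff[symmetric] integrable_continuous_real contE)
    also have "norm \<dots> \<le> integral {0..t} ?g"
    proof (rule integral_norm_bound_integral[OF _ g(1)])
      show "(\<lambda>s. F (E b s) - F (E b' s)) integrable_on {0..t}"
        by (intro integrable_diff integrable_continuous_real contE)
      fix s :: real
      have "norm (E b s - E b' s) = exp (c * s) * dist (apply_bcontfun b s) (apply_bcontfun b' s)"
        by (simp add: E_def dist_norm scaleR_diff_right[symmetric])
      also have "\<dots> \<le> exp (c * s) * dist b b'"
        by (intro mult_left_mono dist_bounded) auto
      finally have "L * norm (E b s - E b' s) \<le> ?g s"
        using L0 by (simp add: mult_left_mono mult.assoc mult.commute[of "dist b b'"])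
      moreover have "norm (F (E b s) - F (E b' s)) \<le> L * norm (E b s - E b' s)"
        using F by (auto intro: lipschitz_on_normD)
      ultimately show "norm (F (E b s) - F (E b' s)) \<le> ?g s"
        by (rule order_trans[rotated])
    qed
    also have "\<dots> \<le> L / c * dist b b' * exp (c * t)"
      unfolding g(2) using L0 c(1) by (intro mult_left_mono) auto
    also have "\<dots> = exp (c * t) * (L / c * dist b b')"
      by (rule mult.commute)
    finally show ?thesis .
  qed
  have K0_dist: "dist (K0 b t) (K0 b' t) \<le> L / c * dist b b'" for b b' t
  proof -
    let ?m = "max 0 t"
    have "dist (K0 b t) (K0 b' t) = exp (- c * ?m) * norm (J b ?m - J b' ?m)"
      by (simp add: K0_def dist_norm scaleR_diff_right[symmetric])
    also have "\<dots> \<le> exp (- c * ?m) * (exp (c * ?m) * (L / c * dist b b'))"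
      by (intro mult_left_mono J_dist) auto
    finally show ?thesis by (simp add: mult.assoc[symmetric] exp_add[symmetric])
  qed
  \<comment> \<open>Boundedness of the image: compare with the image of zero, where the integrand is constant.\<close>
  have "norm (K0 0 t) \<le> norm (F z) / c" for t
  proof -
    let ?m = "max 0 t"
    have "norm (K0 0 t) = exp (- c * ?m) * ?m * norm (F z)"
      by (simp add: K0_def J_def E_def zero_bcontfun.rep_eq)
    also have "exp (- c * ?m) * ?m \<le> 1 / c"
    proof -
      have "c * ?m \<le> exp (c * ?m)" using exp_ge_add_one_self[of "c * ?m"] by linarith
      then show ?thesis using c by (simp add: exp_minus field_simps)
    qed
    finally show ?thesis by (simp add: mult_right_mono)
  qed
  then have "norm (K0 b t) \<le> norm (F z) / c + L / c * dist b 0" for b t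
    using K0_dist[of b t 0] norm_triangle_sub[of "K0 b t" "K0 0 t"]
    by (smt (verit) dist_norm)
  moreover have "continuous_on UNIV (K0 b)" for b
    unfolding K0_def by (intro continuous_intros continuous_on_compose2[OF contJ]) auto
  ultimately have K0_bcontfun: "K0 b \<in> bcontfun" for b
    unfolding bcontfun_def bounded_iff by blast
  define K where "K b = Bcontfun (K0 b)" for b
  have K: "apply_bcontfun (K b) = K0 b" for b
    unfolding K_def using K0_bcontfun by (simp add: Bcontfun_inverse)
  have "dist (K b) (K b') \<le> L / c * dist b b'" for b b'
    by (rule dist_bound) (simp only: K K0_dist)
  then have "\<exists>!b. K b = b"
    using c L0 by (intro banach_fix_type[of "L / c"]) auto
  then obtain b where b: "K b = b" by blast
  have Eb: "E b t = z + J b t" if "0 \<le> t" for t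
  proof -
    have "apply_bcontfun b t = exp (- c * t) *\<^sub>R J b t"
      using that K[of b] unfolding b by (simp add: K0_def)
    then show ?thesis by (simp add: E_def exp_add[symmetric])
  qed
  show thesis
  proof
    show "E b 0 = z" using Eb[of 0] by (simp add: J_def)
    show "(E b has_vector_derivative F (E b t)) (at t within {0..})" if "0 \<le> t" for t
    proof (rule has_vector_derivative_transform)
      show "((\<lambda>t. z + J b t) has_vector_derivative F (E b t)) (at t within {0..})"
        using has_vector_derivative_add[OF has_vector_derivative_const J[OF that]] by simp
    qed (use that Eb in auto)
  qed
qed

text \<open>
  By uniqueness the forward solution \<open>y\<close> from \<open>x a\<close> satisfies \<open>y (t + \<tau>) = y t\<close> for \<open>t \<ge> 0\<close>, where
  \<open>\<tau> = b - a\<close>. Negative times are reached by first adding enough periods, which is consistent and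
  also settles differentiability, since around each time one may work at a positive time of \<open>y\<close>.
\<close>

lemma lipschitz_closed_solution_extends:
  fixes F :: "'a::euclidean_space \<Rightarrow> 'a"
  assumes F: "L-lipschitz_on UNIV F"
    and x: "\<And>t. t \<in> {a..b} \<Longrightarrow> (x has_vector_derivative F (x t)) (at t within {a..b})"
    and ab: "a < b" "x a = x b"
  shows "\<exists>\<omega>. (\<forall>t. (\<omega> has_vector_derivative F (\<omega> t)) (at t)) \<and>
    (\<forall>t. \<omega> (t + (b - a)) = \<omega> t) \<and> range \<omega> = x ` {a..b}"
proof -
  define \<tau> where "\<tau> = b - a"
  have \<tau>: "\<tau> > 0" using ab by (simp add: \<tau>_def)
  obtain y where y0: "y 0 = x a"
    and y: "\<And>t. 0 \<le> t \<Longrightarrow> (y has_vector_derivative F (y t)) (at t within {0..})"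
    using lipschitz_solution_exists[OF F] by metis
  have unique: "u t = v t"
    if "\<And>s. s \<in> {0..t} \<Longrightarrow> (u has_vector_derivative F (u s)) (at s within {0..t})"
      "\<And>s. s \<in> {0..t} \<Longrightarrow> (v has_vector_derivative F (v s)) (at s within {0..t})"
      "u 0 = v 0" "0 \<le> t" for u v and t :: real
    using lipschitz_solutions_dist[OF F that(1,2), of t] that(3,4) by simp
  have y_within: "(y has_vector_derivative F (y s)) (at s within S)" if "0 \<le> s" "S \<subseteq> {0..}" for s S
    using y[OF that(1)] that(2) by (rule has_vector_derivative_within_subset)
  have yx: "y t = x (t + a)" if "t \<in> {0..\<tau>}" for t
  proof (rule unique[where u = y and v = "\<lambda>t. x (t + a)"])
    show "((\<lambda>t. x (t + a)) has_vector_derivative F (x (s + a))) (at s within {0..t})" if "s \<in> {0..t}" for s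
      using that \<open>t \<in> {0..\<tau>}\<close>
      by (intro has_vector_derivative_time_shift[OF x]) (auto simp: \<tau>_def)
  qed (use that y0 in \<open>auto intro!: y_within\<close>)
  have y\<tau>: "y \<tau> = y 0"
    using yx[of \<tau>] y0 \<tau> ab by (simp add: \<tau>_def)
  have step: "y (t + \<tau>) = y t" if "0 \<le> t" for t
  proof (rule unique[where u = "\<lambda>t. y (t + \<tau>)" and v = y])
    show "((\<lambda>t. y (t + \<tau>)) has_vector_derivative F (y (s + \<tau>))) (at s within {0..t})" if "s \<in> {0..t}" for s
      using that \<tau> by (intro has_vector_derivative_time_shift[OF y]) auto
  qed (use that y\<tau> in \<open>auto intro!: y_within\<close>)
  have steps: "y (t + real n * \<tau>) = y t" if "0 \<le> t" for t n
  proof (induction n)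
    case (Suc n)
    then show ?case
      using step[of "t + real n * \<tau>"] that \<tau> by (simp add: algebra_simps)
  qed simp
  define \<omega> where "\<omega> t = y (t + real (nat \<lceil>- t / \<tau>\<rceil>) * \<tau>)" for t
  have \<omega>: "\<omega> t = y (t + real n * \<tau>)" if n: "0 \<le> t + real n * \<tau>" for t n
  proof -
    let ?n = "nat \<lceil>- t / \<tau>\<rceil>"
    have "- t / \<tau> \<le> real n" using n \<tau> by (simp add: field_simps)
    then have "?n \<le> n" by linarith
    have "- t / \<tau> \<le> real ?n" by linarith
    then have "0 \<le> t + real ?n * \<tau>" using \<tau> by (simp add: field_simps)
    then have "y (t + real ?n * \<tau>) = y (t + real ?n * \<tau> + real (n - ?n) * \<tau>)"
      by (rule steps[symmetric])
    also have "t + real ?n * \<tau> + real (n - ?n) * \<tau> = t + real n * \<tau>"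
      using \<open>?n \<le> n\<close> by (simp add: of_nat_diff algebra_simps)
    finally show ?thesis unfolding \<omega>_def .
  qed
  have shift_pos: "\<exists>n. 0 < t + real n * \<tau>" for t
  proof -
    obtain n where "- t < real n * \<tau>" using reals_Archimedean3[OF \<tau>] by blast
    then show ?thesis by (intro exI[of _ n]) simp
  qed
  show ?thesis
  proof (intro exI[of _ \<omega>] conjI allI)
    fix t
    obtain n where n: "0 < t + real n * \<tau>" using shift_pos by blast
    let ?S = "{- real n * \<tau><..}"
    have "((\<lambda>t. y (t + real n * \<tau>)) has_vector_derivative F (\<omega> t)) (at t within ?S)"
      unfolding \<omega>[OF less_imp_le[OF n]] using n by (intro has_vector_derivative_time_shift[OF y]) auto
    then have deriv: "((\<lambda>t. y (t + real n * \<tau>)) has_vector_derivative F (\<omega> t)) (at t)"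
      using n by (subst (asm) has_vector_derivative_within_open) auto
    have eq: "y (s + real n * \<tau>) = \<omega> s" if "s \<in> ?S" for s
      using that \<omega>[of s n] by simp
    show "(\<omega> has_vector_derivative F (\<omega> t)) (at t)"
      by (rule has_vector_derivative_transform_within_open[where S = ?S, OF deriv _ _ eq]) (use n in auto)
  next
    fix t
    obtain n where n: "0 < t + real n * \<tau>" using shift_pos by blast
    have "0 \<le> t + (b - a) + real n * \<tau>" using n ab by simp
    then have "\<omega> (t + (b - a)) = y (t + real n * \<tau> + \<tau>)"
      using \<omega> by (simp add: \<tau>_def algebra_simps)
    then show "\<omega> (t + (b - a)) = \<omega> t"
      using step[of "t + real n * \<tau>"] n \<omega>[of t n] by simp
  next
    show "range \<omega> = x ` {a..b}"
    proof (intro equalityI subsetI)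
      fix w assume "w \<in> range \<omega>"
      then obtain s where s: "w = y s" "0 \<le> s"
        using shift_pos \<omega> by (metis imageE less_imp_le)
      define n where "n = nat \<lfloor>s / \<tau>\<rfloor>"
      define r where "r = s - real n * \<tau>"
      have "real n = of_int \<lfloor>s / \<tau>\<rfloor>" using s \<tau> by (simp add: n_def)
      then have "real n \<le> s / \<tau>" "s / \<tau> < real n + 1" by linarith+
      then have r: "r \<in> {0..\<tau>}" using \<tau> by (simp add: r_def field_simps)
      then have "w = x (r + a)" using steps[of r n] s yx[OF r] by (simp add: r_def)
      moreover have "r + a \<in> {a..b}" using r by (simp add: \<tau>_def)
      ultimately show "w \<in> x ` {a..b}" by (rule image_eqI)
    next
      fix w assume "w \<in> x ` {a..b}"
      then obtain s where s: "s \<in> {a..b}" "w = x s" by blast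
      then have "w = y (s - a)" using yx[of "s - a"] by (simp add: \<tau>_def)
      also have "\<dots> = \<omega> (s - a)" using \<omega>[of "s - a" 0] s by simp
      finally show "w \<in> range \<omega>" by blast
    qed
  qed
qed

section \<open>Solutions of polynomial systems\<close>

lemma solution_on_subset: "solution_on P Q I \<phi> \<Longrightarrow> J \<subseteq> I \<Longrightarrow> solution_on P Q J \<phi>"
  unfolding solution_on_def by (meson has_vector_derivative_within_subset subsetD)

lemma solution_on_continuous: "solution_on P Q I \<phi> \<Longrightarrow> continuous_on I \<phi>"
  unfolding solution_on_def
  by (meson continuous_on_eq_continuous_within has_vector_derivative_continuous)

lemma eval2_along_solution:
  assumes "solution_on P Q I \<phi>" "t \<in> I"
  shows "((\<lambda>t. eval2 p (\<phi> t)) has_real_derivative eval2 (pdx p * P + pdy p * Q) (\<phi> t)) (at t within I)"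
proof -
  have "(\<phi> has_derivative (\<lambda>h. h *\<^sub>R vfield P Q (\<phi> t))) (at t within I)"
    using assms by (simp add: solution_on_def has_vector_derivative_def)
  from has_derivative_compose[OF this eval2_has_derivative[of p]]
  show ?thesis
    unfolding has_field_derivative_def
    by (rule has_derivative_eq_rhs) (simp add: fun_eq_iff vfield_def algebra_simps)
qed

lemma eval2_bounded_on_cball:
  obtains C where "\<And>z. z \<in> cball 0 R \<Longrightarrow> \<bar>eval2 p z\<bar> \<le> C"
proof -
  have "compact (eval2 p ` cball 0 R)"
    by (intro compact_continuous_image continuous_on_eval2[of _ id, simplified]) auto
  then obtain C where "\<forall>z\<in>cball 0 R. \<bar>eval2 p z\<bar> \<le> C"
    by (auto simp: bounded_iff simp del: mem_cball dest!: compact_imp_bounded)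
  then show thesis using that by blast
qed

lemma eval2_lipschitz_on_cball: "\<exists>L. L-lipschitz_on (cball 0 R) (eval2 p)"
proof -
  obtain A B where A: "\<And>z. z \<in> cball 0 R \<Longrightarrow> \<bar>eval2 (pdx p) z\<bar> \<le> A"
    and B: "\<And>z. z \<in> cball 0 R \<Longrightarrow> \<bar>eval2 (pdy p) z\<bar> \<le> B"
    using eval2_bounded_on_cball by metis
  have "(\<bar>A\<bar> + \<bar>B\<bar>)-lipschitz_on (cball 0 R) (eval2 p)"
  proof (rule bounded_derivative_imp_lipschitz)
    fix z :: "real \<times> real" assume z: "z \<in> cball 0 R"
    show "(eval2 p has_derivative (\<lambda>v. eval2 (pdx p) z * fst v + eval2 (pdy p) z * snd v)) (at z within cball 0 R)"
      by (rule eval2_has_derivative)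
    show "onorm (\<lambda>v. eval2 (pdx p) z * fst v + eval2 (pdy p) z * snd v) \<le> \<bar>A\<bar> + \<bar>B\<bar>"
    proof (rule onorm_le)
      fix v :: "real \<times> real"
      have "\<bar>eval2 (pdx p) z * fst v\<bar> \<le> \<bar>A\<bar> * norm v"
        unfolding abs_mult using A[OF z] norm_fst_le[of "fst v" "snd v"] by (intro mult_mono) auto
      moreover have "\<bar>eval2 (pdy p) z * snd v\<bar> \<le> \<bar>B\<bar> * norm v"
        unfolding abs_mult using B[OF z] norm_snd_le[of "snd v" "fst v"] by (intro mult_mono) auto
      ultimately show "norm (eval2 (pdx p) z * fst v + eval2 (pdy p) z * snd v) \<le> (\<bar>A\<bar> + \<bar>B\<bar>) * norm v"
        by (simp add: algebra_simps abs_le_iff)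
    qed
  qed auto
  then show ?thesis by blast
qed

text \<open>
  Precomposing with the nearest-point projection onto the ball makes a polynomial field globally
  Lipschitz without changing it inside the ball, so that the global theory above applies to
  solutions confined to the ball.
\<close>

lemma vfield_lipschitz_truncation:
  assumes "0 \<le> R"
  obtains L F where "L-lipschitz_on UNIV F" "\<And>z. z \<in> cball 0 R \<Longrightarrow> F z = vfield P Q z"
proof -
  let ?c = "closest_point (cball (0 :: real \<times> real) R)"
  obtain A B where "A-lipschitz_on (cball 0 R) (eval2 P)" "B-lipschitz_on (cball 0 R) (eval2 Q)"
    using eval2_lipschitz_on_cball by metis
  then have "(sqrt (A\<^sup>2 + B\<^sup>2))-lipschitz_on (cball 0 R) (vfield P Q)"
    unfolding vfield_def by (rule lipschitz_on_Pair)
  moreover have "range ?c \<subseteq> cball 0 R"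
  proof (rule image_subsetI)
    fix w show "?c w \<in> cball 0 R" by (rule closest_point_in_set) (use assms in auto)
  qed
  moreover have "1-lipschitz_on UNIV ?c"
    using assms by (intro lipschitz_onI) (auto intro!: closest_point_lipschitz)
  ultimately have "(sqrt (A\<^sup>2 + B\<^sup>2) * 1)-lipschitz_on UNIV (vfield P Q \<circ> ?c)"
    by (intro lipschitz_on_compose) (auto intro: lipschitz_on_subset)
  then show thesis
    by (rule that) (simp add: closest_point_self)
qed

lemma solution_range_in_cball:
  assumes "solution_on P Q {a..b} \<phi>"
  obtains R where "0 \<le> R" "\<phi> ` {a..b} \<subseteq> cball 0 R"
proof -
  have "compact (\<phi> ` {a..b})"
    using assms by (intro compact_continuous_image solution_on_continuous) auto
  then have "bounded (\<phi> ` {a..b})" by (rule compact_imp_bounded)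
  then obtain R where R: "\<forall>w\<in>\<phi> ` {a..b}. norm w \<le> R" unfolding bounded_iff by blast
  have "\<phi> ` {a..b} \<subseteq> cball 0 (max R 0)"
  proof
    fix w assume "w \<in> \<phi> ` {a..b}"
    then have "norm w \<le> R" using R by blast
    then show "w \<in> cball 0 (max R 0)" by simp
  qed
  then show thesis by (rule that[rotated]) simp
qed

text \<open>
  Solutions starting near \<open>\<phi> 0\<close> exist as long as \<open>\<phi>\<close> does and stay close to it: Gronwall controls
  the solutions of the truncated field, and being within \<open>e\<close> of \<open>\<phi>\<close> they never leave the ball
  where the truncation agrees with the system.
\<close>

lemma continuous_dependence:
  assumes \<phi>: "solution_on P Q {0..S} \<phi>" and "0 < e" "0 \<le> S"
  obtains \<eta> where "0 < \<eta>"
    "\<And>z. dist z (\<phi> 0) < \<eta> \<Longrightarrow>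
       \<exists>\<psi>. \<psi> 0 = z \<and> solution_on P Q {0..S} \<psi> \<and> (\<forall>t\<in>{0..S}. dist (\<psi> t) (\<phi> t) < e)"
proof -
  obtain R where R: "0 \<le> R" "\<phi> ` {0..S} \<subseteq> cball 0 R"
    using solution_range_in_cball[OF \<phi>] by blast
  obtain L F where F: "L-lipschitz_on UNIV F" and Feq: "\<And>z. z \<in> cball 0 (R + e) \<Longrightarrow> F z = vfield P Q z"
    using vfield_lipschitz_truncation[of "R + e"] R \<open>0 < e\<close> by (metis add_nonneg_nonneg less_imp_le)
  have L: "0 \<le> L" using F by (rule lipschitz_on_nonneg)
  show thesis
  proof
    show "0 < e * exp (- L * S)" using \<open>0 < e\<close> by simp
    fix z assume z: "dist z (\<phi> 0) < e * exp (- L * S)"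
    obtain \<psi> where \<psi>0: "\<psi> 0 = z"
      and \<psi>: "\<And>t. 0 \<le> t \<Longrightarrow> (\<psi> has_vector_derivative F (\<psi> t)) (at t within {0..})"
      using lipschitz_solution_exists[OF F] by metis
    have \<psi>S: "(\<psi> has_vector_derivative F (\<psi> t)) (at t within {0..S})" if "t \<in> {0..S}" for t
      using \<psi>[of t] that by (auto intro: has_vector_derivative_within_subset)
    have near: "dist (\<psi> t) (\<phi> t) < e" if t: "t \<in> {0..S}" for t
    proof -
      have "norm (\<psi> t - \<phi> t) \<le> norm (\<psi> 0 - \<phi> 0) * exp (L * (t - 0))"
      proof (rule lipschitz_solutions_dist[OF F \<psi>S _ t])
        show "(\<phi> has_vector_derivative F (\<phi> s)) (at s within {0..S})" if "s \<in> {0..S}" for s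
        proof -
          have "\<phi> s \<in> cball 0 R" using that R by blast
          then have "F (\<phi> s) = vfield P Q (\<phi> s)" using \<open>0 < e\<close> by (intro Feq) simp
          then show ?thesis using \<phi> that by (simp add: solution_on_def)
        qed
      qed
      also have "\<dots> \<le> norm (\<psi> 0 - \<phi> 0) * exp (L * S)"
        using t L by (intro mult_left_mono) (auto intro: mult_left_mono)
      also have "\<dots> < e"
        using z by (simp add: \<psi>0 dist_norm exp_minus field_simps)
      finally show ?thesis by (simp add: dist_norm)
    qed
    have "\<psi> t \<in> cball 0 (R + e)" if t: "t \<in> {0..S}" for t
    proof -
      have "\<phi> t \<in> cball 0 R" using t R by blast
      then have "dist 0 (\<phi> t) \<le> R" by (simp only: mem_cball)
      then have "dist 0 (\<psi> t) \<le> R + e"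
        using near[OF t] dist_triangle2[of 0 "\<psi> t" "\<phi> t"] by linarith
      then show ?thesis by (simp only: mem_cball)
    qed
    then have "solution_on P Q {0..S} \<psi>"
      using \<psi>S Feq unfolding solution_on_def by metis
    with \<psi>0 near show "\<exists>\<psi>. \<psi> 0 = z \<and> solution_on P Q {0..S} \<psi> \<and> (\<forall>t\<in>{0..S}. dist (\<psi> t) (\<phi> t) < e)"
      by blast
  qed
qed

lemma closed_solution_periodic_orbit:
  assumes x: "solution_on P Q {a..b} x" and ab: "a < b" "x a = x b" and nz: "vfield P Q (x a) \<noteq> 0"
  shows "periodic_orbit P Q (x ` {a..b})"
proof -
  obtain R where R: "0 \<le> R" "x ` {a..b} \<subseteq> cball 0 R"
    using solution_range_in_cball[OF x] by blast
  obtain L F where F: "L-lipschitz_on UNIV F" and Feq: "\<And>z. z \<in> cball 0 R \<Longrightarrow> F z = vfield P Q z"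
    using vfield_lipschitz_truncation[OF R(1)] by metis
  have x': "(x has_vector_derivative F (x t)) (at t within {a..b})" if t: "t \<in> {a..b}" for t
  proof -
    have "F (x t) = vfield P Q (x t)" using t R by (intro Feq) blast
    then show ?thesis using x t by (simp add: solution_on_def)
  qed
  obtain \<omega> where \<omega>: "\<And>t. (\<omega> has_vector_derivative F (\<omega> t)) (at t)"
    "\<And>t. \<omega> (t + (b - a)) = \<omega> t" "range \<omega> = x ` {a..b}"
    using lipschitz_closed_solution_extends[of L F a b x] F x' ab by blast
  have "F (\<omega> t) = vfield P Q (\<omega> t)" for t
  proof -
    have "\<omega> t \<in> x ` {a..b}" unfolding \<omega>(3)[symmetric] by (rule rangeI)
    then show ?thesis using R(2) by (intro Feq) (rule subsetD)
  qed
  then have sol: "solution_on P Q UNIV \<omega>"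
    using \<omega>(1) by (simp add: solution_on_def)
  have "\<not> \<omega> constant_on UNIV"
  proof
    assume "\<omega> constant_on UNIV"
    then obtain w where w: "\<And>t. \<omega> t = w" unfolding constant_on_def by blast
    have "(\<omega> has_vector_derivative vfield P Q w) (at 0)"
      using sol w[of 0] unfolding solution_on_def by (metis UNIV_I)
    moreover have "\<omega> = (\<lambda>t. w)" using w by (rule ext)
    ultimately have "((\<lambda>t::real. w) has_vector_derivative vfield P Q w) (at 0)"
      by (simp only:)
    then have "vfield P Q w = 0"
      by (rule vector_derivative_unique_at[OF _ has_vector_derivative_const])
    moreover have "x a \<in> range \<omega>" unfolding \<omega>(3) using ab by simp
    then have "x a = w" by (auto simp: w)
    ultimately show False using nz by (simp only:)
  qed
  moreover have "0 < b - a" using ab by simp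
  ultimately show ?thesis
    unfolding periodic_orbit_def using sol \<omega>(2) \<omega>(3)[symmetric]
    by (intro exI[of _ \<omega>] exI[of _ "b - a"] conjI allI) assumption+
qed

section \<open>Curves meeting a solution in a time interval\<close>

text \<open>
  Along the solution both \<open>p\<close> and its derivative \<open>q = p\<^sub>x P + p\<^sub>y Q\<close> along the flow vanish. If \<open>p\<close> did
  not divide \<open>q\<close>, the common zeros would have finitely many abscissas, so the solution would move
  on a vertical line \<open>x = x0\<close>. Then \<open>x - x0\<close> divides \<open>p\<close> and \<open>P\<close>; hence it is \<open>p\<close> up to a unit, and
  it divides \<open>q\<close> after all. So \<open>p dvd q\<close>, and the quotient is a cofactor.
\<close>

lemma invariant_if_solution_on_curve:
  assumes p: "irreducible p" and sol: "solution_on P Q {a..b} \<phi>" and ab: "a < b"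
    and zero: "\<And>t. t \<in> {a..b} \<Longrightarrow> eval2 p (\<phi> t) = 0"
    and nz: "vfield P Q (\<phi> a) \<noteq> 0"
  obtains k where "invariant_curve P Q p k"
proof -
  define q where "q = pdx p * P + pdy p * Q"
  have const_deriv: "D = 0" if g: "\<And>s. s \<in> {a..b} \<Longrightarrow> g s = c"
    and D: "(g has_vector_derivative D) (at t within {a..b})" and t: "t \<in> {a..b}" for g D t and c :: real
  proof (rule vector_derivative_unique_within_closed_interval)
    show "(g has_vector_derivative D) (at t within cbox a b)" using D by simp
    show "(g has_vector_derivative 0) (at t within cbox a b)"
      using has_vector_derivative_transform[OF t g has_vector_derivative_const] by simp
  qed (use ab t in auto)
  have q0: "eval2 q (\<phi> t) = 0" if t: "t \<in> {a..b}" for t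
    using const_deriv[OF zero _ t] eval2_along_solution[OF sol t, of p]
    by (simp add: q_def has_real_derivative_iff_has_vector_derivative)
  have cont: "continuous_on {a..b} (\<lambda>t. fst (\<phi> t))" "continuous_on {a..b} (\<lambda>t. snd (\<phi> t))"
    using solution_on_continuous[OF sol] by (auto intro: continuous_intros)
  have deriv: "((\<lambda>t. fst (\<phi> t)) has_vector_derivative eval2 P (\<phi> t)) (at t within {a..b})"
    "((\<lambda>t. snd (\<phi> t)) has_vector_derivative eval2 Q (\<phi> t)) (at t within {a..b})"
    if "t \<in> {a..b}" for t
    using sol that
      bounded_linear.has_vector_derivative[OF bounded_linear_fst, of \<phi> "vfield P Q (\<phi> t)"]
      bounded_linear.has_vector_derivative[OF bounded_linear_snd, of \<phi> "vfield P Q (\<phi> t)"]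
    by (auto simp: solution_on_def vfield_def)
  have "p dvd q"
  proof (rule ccontr)
    assume npq: "\<not> p dvd q"
    obtain A B r where r: "A * p + B * q = [:r:]" "r \<noteq> 0"
      using irreducible_combination_without_y[OF p npq] by blast
    have "poly r (fst (\<phi> t)) = 0" if "t \<in> {a..b}" for t
    proof -
      have "eval2 (A * p + B * q) (\<phi> t) = 0"
        using zero[OF that] q0[OF that] by simp
      then show ?thesis unfolding r(1) by simp
    qed
    then have "(\<lambda>t. fst (\<phi> t)) ` {a..b} \<subseteq> {x. poly r x = 0}" by blast
    then have "finite ((\<lambda>t. fst (\<phi> t)) ` {a..b})"
      using poly_roots_finite[OF r(2)] finite_subset by blast
    then obtain x0 where x0: "\<And>t. t \<in> {a..b} \<Longrightarrow> fst (\<phi> t) = x0"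
      using continuous_finite_range_constant[OF _ cont(1)] unfolding constant_on_def
      by (metis connected_Icc)
    have P0: "eval2 P (\<phi> t) = 0" if "t \<in> {a..b}" for t
      using const_deriv[OF x0 deriv(1)[OF that] that] .
    define Y where "Y = (\<lambda>t. snd (\<phi> t)) ` {a..b}"
    \<comment> \<open>Otherwise both coordinates are constant and the solution starts at an equilibrium.\<close>
    have "infinite Y"
    proof
      assume "finite Y"
      then obtain y0 where y0: "\<And>t. t \<in> {a..b} \<Longrightarrow> snd (\<phi> t) = y0"
        using continuous_finite_range_constant[OF _ cont(2)] unfolding constant_on_def Y_def
        by (metis connected_Icc)
      have a: "a \<in> {a..b}" using ab by simp
      have "eval2 Q (\<phi> a) = 0"
        using const_deriv[OF y0 deriv(2)[OF a] a] .
      with P0[OF a] nz show False by (simp add: vfield_def zero_prod_def)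
    qed
    moreover have "Y \<subseteq> {y. eval2 p (x0, y) = 0}" "Y \<subseteq> {y. eval2 P (x0, y) = 0}"
    proof -
      have "(x0, snd (\<phi> t)) = \<phi> t" if "t \<in> {a..b}" for t
        by (simp add: x0[OF that, symmetric])
      then show "Y \<subseteq> {y. eval2 p (x0, y) = 0}" "Y \<subseteq> {y. eval2 P (x0, y) = 0}"
        unfolding Y_def by (auto simp: zero P0 simp del: atLeastAtMost_iff)
    qed
    ultimately have dvd: "[:[:- x0, 1:]:] dvd p" "[:[:- x0, 1:]:] dvd P"
      using vertical_line_dvd finite_subset by blast+
    then obtain e where e: "p = smult [:- x0, 1:] e" by (auto elim!: dvdE)
    have "[:[:- x0, 1:]:] dvd pdy p"
      unfolding pdy_def e pderiv_smult by (rule dvdI[of _ _ "pderiv e"]) simp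
    with dvd(2) have "[:[:- x0, 1:]:] dvd q" unfolding q_def by simp
    moreover have "\<not> [:[:- x0, 1:]:] dvd 1"
    proof
      assume "[:[:- x0, 1:]:] dvd 1"
      then obtain v where "1 = [:[:- x0, 1:]:] * v" by (elim dvdE)
      then have "eval2 1 (x0, 0) = eval2 [:[:- x0, 1:]:] (x0, 0) * eval2 v (x0, 0)"
        by (simp only: eval2_mult[symmetric])
      then show False by (simp add: eval2_def)
    qed
    then have "p dvd [:[:- x0, 1:]:]" using p dvd(1) irreducibleD' by blast
    ultimately show False using npq dvd_trans by blast
  qed
  then obtain k where "q = p * k" by (elim dvdE)
  then have "invariant_curve P Q p k"
    using p by (simp add: invariant_curve_def q_def mult.commute)
  then show thesis by (rule that)
qed

section \<open>Periodic orbits\<close>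

lemma periodic_nat:
  fixes \<phi> :: "real \<Rightarrow> 'a"
  assumes "\<And>t. \<phi> (t + T) = \<phi> t"
  shows "\<phi> (t + real n * T) = \<phi> t"
proof (induction n)
  case (Suc n)
  then show ?case using assms[of "t + real n * T"] by (simp add: algebra_simps)
qed simp

lemma periodic_later:
  fixes \<phi> :: "real \<Rightarrow> 'a"
  assumes "\<And>t. \<phi> (t + T) = \<phi> t" "0 < T"
  obtains t' where "t0 \<le> t'" "\<phi> t' = \<phi> t"
proof -
  obtain n where "t0 - t < real n * T" using reals_Archimedean3[OF assms(2)] by blast
  with periodic_nat[of \<phi> T t n] assms(1) show thesis by (intro that[of "t + real n * T"]) auto
qed

lemma periodic_range:
  fixes \<phi> :: "real \<Rightarrow> 'a"
  assumes per: "\<And>t. \<phi> (t + T) = \<phi> t" and T: "0 < T"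
  shows "range \<phi> = \<phi> ` {0..T}"
proof -
  have "\<phi> t \<in> \<phi> ` {0..T}" for t
  proof -
    obtain t' where t': "0 \<le> t'" "\<phi> t' = \<phi> t"
      using periodic_later[of \<phi> T 0 t] assms by blast
    define n where "n = nat \<lfloor>t' / T\<rfloor>"
    define r where "r = t' - real n * T"
    have "real n = of_int \<lfloor>t' / T\<rfloor>" using t' T by (simp add: n_def)
    then have "real n \<le> t' / T" "t' / T < real n + 1" by linarith+
    then have "r \<in> {0..T}" using T by (simp add: r_def field_simps)
    moreover have "\<phi> r = \<phi> t" using periodic_nat[of \<phi> T r n] per t' by (simp add: r_def)
    ultimately show ?thesis by (metis image_eqI)
  qed
  then show ?thesis by auto
qed

text \<open>
  The function \<open>f\<close> satisfies the linear equation \<open>u' = k u\<close> along a solution. Only the forward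
  direction of uniqueness is stated, as a periodic solution returns to every past point.
\<close>

lemma solution_stays_on_curve:
  assumes sol: "solution_on P Q UNIV \<phi>" and f: "pdx f * P + pdy f * Q = k * f"
    and zero: "eval2 f (\<phi> t0) = 0" and t: "t0 \<le> t"
  shows "eval2 f (\<phi> t) = 0"
proof -
  have sol': "solution_on P Q {t0..t} \<phi>" using sol by (rule solution_on_subset) simp
  obtain R where R: "\<phi> ` {t0..t} \<subseteq> cball 0 R" using solution_range_in_cball[OF sol'] by blast
  obtain C where C: "\<And>z. z \<in> cball 0 R \<Longrightarrow> \<bar>eval2 k z\<bar> \<le> C" using eval2_bounded_on_cball by blast
  have "norm (eval2 f (\<phi> t)) \<le> norm (eval2 f (\<phi> t0)) * exp (C * (t - t0))"
  proof (rule gronwall_norm[where b = t and u' = "\<lambda>s. eval2 (k * f) (\<phi> s)"])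
    fix s assume s: "s \<in> {t0..t}"
    show "((\<lambda>s. eval2 f (\<phi> s)) has_vector_derivative eval2 (k * f) (\<phi> s)) (at s within {t0..t})"
      using eval2_along_solution[OF sol' s, of f]
      by (simp add: f has_real_derivative_iff_has_vector_derivative)
    have "\<bar>eval2 k (\<phi> s)\<bar> \<le> C" using C R s by blast
    then show "norm (eval2 (k * f) (\<phi> s)) \<le> C * norm (eval2 f (\<phi> s))"
      by (simp add: abs_mult mult_right_mono)
  qed (use t in auto)
  then show ?thesis by (simp add: zero)
qed

lemma solution_stays_at_equilibrium:
  assumes sol: "solution_on P Q UNIV \<phi>" and zero: "vfield P Q (\<phi> t0) = 0" and t: "t0 \<le> t"
  shows "\<phi> t = \<phi> t0"
proof -
  have sol': "solution_on P Q {t0..t} \<phi>" using sol by (rule solution_on_subset) simp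
  obtain R where R: "0 \<le> R" "\<phi> ` {t0..t} \<subseteq> cball 0 R" using solution_range_in_cball[OF sol'] by blast
  obtain L F where F: "L-lipschitz_on UNIV F" and Feq: "\<And>z. z \<in> cball 0 R \<Longrightarrow> F z = vfield P Q z"
    using vfield_lipschitz_truncation[OF R(1)] by metis
  have Fv: "F (\<phi> s) = vfield P Q (\<phi> s)" if "s \<in> {t0..t}" for s
    using Feq R(2) that by blast
  have "norm (\<phi> t - \<phi> t0) \<le> norm (\<phi> t0 - \<phi> t0) * exp (L * (t - t0))"
  proof (rule lipschitz_solutions_dist[OF F, where b = t and y = "\<lambda>s. \<phi> t0"])
    fix s assume "s \<in> {t0..t}"
    then show "(\<phi> has_vector_derivative F (\<phi> s)) (at s within {t0..t})"
      using sol' Fv by (simp add: solution_on_def)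
    show "((\<lambda>s. \<phi> t0) has_vector_derivative F (\<phi> t0)) (at s within {t0..t})"
      using Fv[of t0] t zero by simp
  qed (use t in auto)
  then show ?thesis by simp
qed

text \<open>
  A periodic orbit contains no equilibrium, since a solution meeting one is constant from then on
  and hence, being periodic, always.
\<close>

lemma periodic_orbitE:
  assumes "periodic_orbit P Q \<Gamma>"
  obtains \<phi> T where "solution_on P Q UNIV \<phi>" "0 < T" "\<And>t. \<phi> (t + T) = \<phi> t" "\<Gamma> = range \<phi>"
    "\<And>t. vfield P Q (\<phi> t) \<noteq> 0"
proof -
  obtain \<phi> T where sol: "solution_on P Q UNIV \<phi>" and T: "0 < T" and per: "\<And>t. \<phi> (t + T) = \<phi> t"
    and nc: "\<not> \<phi> constant_on UNIV" and \<Gamma>: "\<Gamma> = range \<phi>"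
    using assms unfolding periodic_orbit_def by blast
  have "vfield P Q (\<phi> t) \<noteq> 0" for t
  proof
    assume z: "vfield P Q (\<phi> t) = 0"
    have "\<phi> s = \<phi> t" for s
    proof -
      obtain s' where "t \<le> s'" "\<phi> s' = \<phi> s"
        using periodic_later[of \<phi> T t s] per T by blast
      then show ?thesis using solution_stays_at_equilibrium[OF sol z] by metis
    qed
    with nc show False unfolding constant_on_def by blast
  qed
  with sol T per \<Gamma> show thesis using that[of \<phi> T] by blast
qed

lemma periodic_solution_off_curve:
  assumes sol: "solution_on P Q UNIV \<phi>" and T: "0 < T" and per: "\<And>t. \<phi> (t + T) = \<phi> t"
    and f: "invariant_curve P Q f k" and off: "\<not> range \<phi> \<subseteq> zero_set f"
  shows "eval2 f (\<phi> t) \<noteq> 0"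
proof
  assume z: "eval2 f (\<phi> t) = 0"
  have "eval2 f (\<phi> s) = 0" for s
  proof -
    obtain s' where "t \<le> s'" "\<phi> s' = \<phi> s"
      using periodic_later[of \<phi> T t s] per T by blast
    then show ?thesis
      using solution_stays_on_curve[OF sol _ z, of k s'] f by (simp add: invariant_curve_def)
  qed
  with off show False by (auto simp: zero_set_def)
qed

text \<open>
  A periodic monotone function is constant.
\<close>

lemma periodic_monotone_derivative_zero:
  fixes u :: "real \<Rightarrow> real"
  assumes per: "\<And>t. u (t + T) = u t" and T: "0 < T"
    and u: "\<And>t. (u has_real_derivative u' t) (at t)" and nonneg: "\<And>t. 0 \<le> u' t"
  shows "u' t = 0"
proof (rule DERIV_local_const[OF u T])
  have mono: "u r \<le> u s" if "r \<le> s" for r s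
    using that
  proof (rule DERIV_nonneg_imp_nondecreasing)
    show "\<exists>y. (u has_real_derivative y) (at x) \<and> 0 \<le> y" for x
      using u[of x] nonneg[of x] by (intro exI[of _ "u' x"] conjI)
  qed
  show "\<forall>s. \<bar>t - s\<bar> < T \<longrightarrow> u t = u s"
  proof (intro allI impI)
    fix s assume s: "\<bar>t - s\<bar> < T"
    show "u t = u s"
    proof (cases "t \<le> s")
      case True
      then show ?thesis using mono[of t s] mono[of s "t + T"] per[of t] s by simp
    next
      case False
      then show ?thesis using mono[of s t] mono[of "t - T" s] per[of "t - T"] s by simp
    qed
  qed
qed

section \<open>Darboux functions\<close>

definition darboux :: "poly2 \<Rightarrow> poly2 \<Rightarrow> real \<Rightarrow> real \<times> real \<Rightarrow> real" where
  "darboux g f \<alpha> z = eval2 g z * \<bar>eval2 f z\<bar> powr \<alpha>"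

text \<open>
  The gradient of the Darboux function is \<open>\<bar>f\<bar>\<^sup>\<alpha> / f\<close> times the pair of polynomials below. This
  non-vanishing scalar factor apart, questions about critical points of the Darboux function
  are questions about polynomials.
\<close>

definition darboux_dx :: "poly2 \<Rightarrow> poly2 \<Rightarrow> real \<Rightarrow> poly2" where
  "darboux_dx g f \<alpha> = f * pdx g + [:[:\<alpha>:]:] * g * pdx f"

definition darboux_dy :: "poly2 \<Rightarrow> poly2 \<Rightarrow> real \<Rightarrow> poly2" where
  "darboux_dy g f \<alpha> = f * pdy g + [:[:\<alpha>:]:] * g * pdy f"

text \<open>
  Multiplied by the factor \<open>\<bar>f\<bar>\<^sup>\<alpha> / f\<close> of the gradient, this identity says that \<open>\<bar>f\<bar>\<^sup>\<alpha> N\<close> is the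
  derivative of the Darboux function along the flow.
\<close>

lemma darboux_N_poly:
  assumes "pdx f * P + pdy f * Q = k * f"
  shows "darboux_dx g f \<alpha> * P + darboux_dy g f \<alpha> * Q = f * N_poly P Q k \<alpha> g"
proof -
  have "darboux_dx g f \<alpha> * P + darboux_dy g f \<alpha> * Q =
      f * (pdx g * P + pdy g * Q) + [:[:\<alpha>:]:] * g * (pdx f * P + pdy f * Q)"
    by (simp only: darboux_dx_def darboux_dy_def distrib_left distrib_right mult_ac add_ac)
  also have "\<dots> = f * N_poly P Q k \<alpha> g"
    unfolding assms N_poly_def by (simp only: distrib_left mult_ac add_ac)
  finally show ?thesis .
qed

lemma has_real_derivative_abs_powr:
  fixes y :: real
  assumes "y \<noteq> 0"
  shows "((\<lambda>y. \<bar>y\<bar> powr \<alpha>) has_real_derivative \<alpha> * \<bar>y\<bar> powr \<alpha> / y) (at y)"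
proof -
  \<comment> \<open>On the side of zero containing \<open>y\<close>, the absolute value is multiplication by the sign of \<open>y\<close>.\<close>
  have "((\<lambda>w. (sgn y * w) powr \<alpha>) has_real_derivative \<alpha> * \<bar>y\<bar> powr \<alpha> / y) (at y)"
    using assms
    by (auto intro!: derivative_eq_intros simp: sgn_if abs_if powr_diff field_simps)
  then show ?thesis
  proof (rule has_field_derivative_transform_within_open)
    show "open {w. 0 < sgn y * w}" by (intro open_Collect_less continuous_intros)
  qed (use assms in \<open>auto simp: sgn_if abs_if split: if_splits\<close>)
qed

lemma darboux_has_derivative:
  assumes "eval2 f z \<noteq> 0"
  shows "(darboux g f \<alpha> has_derivative
    (\<lambda>v. \<bar>eval2 f z\<bar> powr \<alpha> / eval2 f z *
       (eval2 (darboux_dx g f \<alpha>) z * fst v + eval2 (darboux_dy g f \<alpha>) z * snd v))) (at z within S)"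
proof -
  have "((\<lambda>z. \<bar>eval2 f z\<bar> powr \<alpha>) has_derivative
     (\<lambda>v. \<alpha> * \<bar>eval2 f z\<bar> powr \<alpha> / eval2 f z * (eval2 (pdx f) z * fst v + eval2 (pdy f) z * snd v)))
     (at z within S)"
    using DERIV_compose_FDERIV[OF has_real_derivative_abs_powr[OF assms, of \<alpha>] eval2_has_derivative]
    by (simp add: mult.commute)
  from has_derivative_mult[OF eval2_has_derivative this]
  show ?thesis
    unfolding darboux_def[abs_def]
    by (rule has_derivative_eq_rhs)
       (use assms in \<open>simp add: fun_eq_iff darboux_dx_def darboux_dy_def field_simps\<close>)
qed

lemma darboux_along_solution:
  assumes sol: "solution_on P Q I \<phi>" and t: "t \<in> I" and f: "pdx f * P + pdy f * Q = k * f"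
    and nz: "eval2 f (\<phi> t) \<noteq> 0"
  shows "((\<lambda>t. darboux g f \<alpha> (\<phi> t)) has_real_derivative
    \<bar>eval2 f (\<phi> t)\<bar> powr \<alpha> * eval2 (N_poly P Q k \<alpha> g) (\<phi> t)) (at t within I)"
proof -
  have "(\<phi> has_derivative (\<lambda>h. h *\<^sub>R vfield P Q (\<phi> t))) (at t within I)"
    using sol t by (simp add: solution_on_def has_vector_derivative_def)
  from has_derivative_compose[OF this darboux_has_derivative[OF nz]]
  have "((\<lambda>t. darboux g f \<alpha> (\<phi> t)) has_real_derivative
    \<bar>eval2 f (\<phi> t)\<bar> powr \<alpha> / eval2 f (\<phi> t) *
      eval2 (darboux_dx g f \<alpha> * P + darboux_dy g f \<alpha> * Q) (\<phi> t)) (at t within I)"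
    unfolding has_field_derivative_def
    by (rule has_derivative_eq_rhs) (simp add: fun_eq_iff vfield_def algebra_simps)
  then show ?thesis
    unfolding darboux_N_poly[OF f] using nz by simp
qed

text \<open>
  On a periodic orbit off the curve \<open>f = 0\<close> the Darboux function is differentiable, monotone
  and periodic, so its derivative \<open>\<bar>f\<bar>\<^sup>\<alpha> N\<close> vanishes identically. Thus the orbit lies in \<open>h = 0\<close>, for
  some time on one irreducible component of it, which is then invariant.
\<close>

lemma no_periodic_orbit_off_curve:
  assumes f: "invariant_curve P Q f k" and N: "no_sign_change (N_poly P Q k \<alpha> g)"
    and h: "noninvariant_curve P Q h" and sub: "zero_set (N_poly P Q k \<alpha> g) \<subseteq> zero_set h"
    and \<Gamma>: "periodic_orbit P Q \<Gamma>"
  shows "\<Gamma> \<subseteq> zero_set f"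
proof (rule ccontr)
  assume off: "\<not> \<Gamma> \<subseteq> zero_set f"
  obtain \<phi> T where sol: "solution_on P Q UNIV \<phi>" and T: "0 < T" and per: "\<And>t. \<phi> (t + T) = \<phi> t"
    and \<Gamma>: "\<Gamma> = range \<phi>" and nz: "\<And>t. vfield P Q (\<phi> t) \<noteq> 0"
    using periodic_orbitE[OF \<Gamma>] by blast
  have fnz: "eval2 f (\<phi> t) \<noteq> 0" for t
    using periodic_solution_off_curve[of P Q \<phi> T f k] sol T per f off \<Gamma> by blast
  let ?N = "\<lambda>t. \<bar>eval2 f (\<phi> t)\<bar> powr \<alpha> * eval2 (N_poly P Q k \<alpha> g) (\<phi> t)"
  have deriv: "((\<lambda>t. darboux g f \<alpha> (\<phi> t)) has_real_derivative ?N t) (at t)" for t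
    using darboux_along_solution[OF sol _ _ fnz] f by (simp add: invariant_curve_def)
  have "?N t = 0" for t
  proof (cases "\<forall>z. 0 \<le> eval2 (N_poly P Q k \<alpha> g) z")
    case True
    show ?thesis
    proof (rule periodic_monotone_derivative_zero[where u = "\<lambda>t. darboux g f \<alpha> (\<phi> t)" and T = T and u' = ?N])
      show "0 \<le> ?N t" for t using spec[OF True, of "\<phi> t"] by simp
    qed (use per T deriv in auto)
  next
    case False
    then have nonpos: "eval2 (N_poly P Q k \<alpha> g) z \<le> 0" for z
      using N unfolding no_sign_change_def by blast
    have "- ?N t = 0"
    proof (rule periodic_monotone_derivative_zero
        [where u = "\<lambda>t. - darboux g f \<alpha> (\<phi> t)" and T = T and u' = "\<lambda>t. - ?N t"])
      show "0 \<le> - ?N t" for t using nonpos by (simp add: mult_nonneg_nonpos)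
      show "((\<lambda>t. - darboux g f \<alpha> (\<phi> t)) has_real_derivative - ?N t) (at t)" for t
        using deriv by (rule DERIV_minus)
    qed (use per T in auto)
    then show ?thesis by simp
  qed
  then have "\<phi> t \<in> zero_set (N_poly P Q k \<alpha> g)" for t
    using fnz by (simp add: zero_set_def)
  then have h0: "eval2 h (\<phi> t) = 0" for t
    using sub by (auto simp: zero_set_def)
  have "h \<noteq> 0" using h by (simp add: noninvariant_curve_def)
  then obtain p c d where p: "irreducible p" "p dvd h" and "c < d"
    and p0: "\<And>t. t \<in> {c..d} \<Longrightarrow> eval2 p (\<phi> t) = 0"
    using irreducible_factor_on_interval[of h 0 1 \<phi>] h0
      continuous_on_subset[OF solution_on_continuous[OF sol]]
    by (metis subset_UNIV zero_less_one)
  obtain k' where "invariant_curve P Q p k'"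
    using invariant_if_solution_on_curve[OF p(1) solution_on_subset[OF sol] \<open>c < d\<close> p0 nz] by blast
  with h p show False unfolding noninvariant_curve_def by blast
qed

section \<open>First integrals\<close>

lemma open_off_curve: "open (- zero_set f)"
proof -
  have "open {z. eval2 f z \<noteq> 0}"
    by (intro open_Collect_neq continuous_on_eval2 continuous_on_id continuous_on_const)
  then show ?thesis by (simp add: zero_set_def Collect_neg_eq)
qed

text \<open>
  Constancy on one open set spreads to every component of the complement of \<open>f = 0\<close>, even though
  these components are separated by the curve: the gradient polynomials vanish on the open set,
  hence identically.
\<close>

lemma darboux_constant_on_open_imp_gradient_zero:
  assumes V: "open V" "V \<noteq> {}" "V \<subseteq> - zero_set f" and const: "darboux g f \<alpha> constant_on V"
  shows "darboux_dx g f \<alpha> = 0" "darboux_dy g f \<alpha> = 0"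
proof -
  obtain c where c: "\<And>z. z \<in> V \<Longrightarrow> darboux g f \<alpha> z = c"
    using const unfolding constant_on_def by blast
  have grad: "eval2 (darboux_dx g f \<alpha>) z = 0 \<and> eval2 (darboux_dy g f \<alpha>) z = 0" if z: "z \<in> V" for z
  proof -
    have nz: "eval2 f z \<noteq> 0" using V(3) z by (auto simp: zero_set_def)
    let ?c = "\<bar>eval2 f z\<bar> powr \<alpha> / eval2 f z"
    have "(darboux g f \<alpha> has_derivative (\<lambda>v. 0)) (at z)"
      by (rule has_derivative_transform_within_open[OF has_derivative_const[of c] V(1) z]) (simp add: c)
    from has_derivative_unique[OF this darboux_has_derivative[OF nz]]
    have eq: "?c * (eval2 (darboux_dx g f \<alpha>) z * fst v + eval2 (darboux_dy g f \<alpha>) z * snd v) = 0" for v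
      by (metis (no_types, lifting))
    show ?thesis using eq[of "(1, 0)"] eq[of "(0, 1)"] nz by simp
  qed
  show "darboux_dx g f \<alpha> = 0" "darboux_dy g f \<alpha> = 0"
    using grad by (auto intro: poly2_eq_0_if_vanishes_on_open[OF V(1,2)])
qed

lemma darboux_gradient_zero_imp_piecewise_constant:
  assumes "darboux_dx g f \<alpha> = 0" "darboux_dy g f \<alpha> = 0"
  shows "piecewise_constant_on (- zero_set f) (darboux g f \<alpha>)"
  unfolding piecewise_constant_on_def
proof
  fix C assume C: "C \<in> components (- zero_set f)"
  have deriv: "(darboux g f \<alpha> has_derivative (\<lambda>v. 0)) (at z within C)" if "z \<in> C" for z
  proof -
    have "eval2 f z \<noteq> 0" using in_components_subset[OF C] that by (auto simp: zero_set_def)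
    from darboux_has_derivative[OF this, of g \<alpha> C] show ?thesis by (simp add: assms)
  qed
  show "darboux g f \<alpha> constant_on C"
  proof (rule has_derivative_zero_connected_constant_on)
    show "connected C" using C by (rule in_components_connected)
    show "open C" using open_components[OF open_off_curve C] .
    show "continuous_on C (darboux g f \<alpha>)" using deriv by (rule has_derivative_continuous_on)
  qed (use deriv in auto)
qed

lemma darboux_constant_along_solution:
  assumes f: "pdx f * P + pdy f * Q = k * f" and N: "N_poly P Q k \<alpha> g = 0"
    and I: "is_interval I" and sol: "solution_on P Q I \<phi>" and sub: "\<phi> ` I \<subseteq> - zero_set f"
  shows "(\<lambda>t. darboux g f \<alpha> (\<phi> t)) constant_on I"
proof -
  have "((\<lambda>t. darboux g f \<alpha> (\<phi> t)) has_derivative (\<lambda>h. 0)) (at t within I)" if "t \<in> I" for t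
  proof -
    have "eval2 f (\<phi> t) \<noteq> 0" using sub that by (auto simp: zero_set_def)
    from darboux_along_solution[OF sol that f this, of g \<alpha>]
    show ?thesis by (simp add: N has_field_derivative_def lambda_zero)
  qed
  then show ?thesis
    using has_derivative_zero_constant[of I "\<lambda>t. darboux g f \<alpha> (\<phi> t)"] I
    by (auto simp: constant_on_def is_interval_convex)
qed

lemma darboux_first_integral:
  assumes f: "invariant_curve P Q f k" and N: "N_poly P Q k \<alpha> g = 0"
    and nc: "\<not> piecewise_constant_on (- zero_set f) (darboux g f \<alpha>)"
  shows "first_integral P Q (- zero_set f) (darboux g f \<alpha>)"
  unfolding first_integral_def
proof (intro conjI allI impI)
  let ?U = "- zero_set f"
  define H' :: "real \<times> real \<Rightarrow> (real \<times> real) \<Rightarrow>\<^sub>L real" where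
    "H' z = (\<bar>eval2 f z\<bar> powr \<alpha> / eval2 f z) *\<^sub>R
       (eval2 (darboux_dx g f \<alpha>) z *\<^sub>R Blinfun fst + eval2 (darboux_dy g f \<alpha>) z *\<^sub>R Blinfun snd)" for z
  show "open ?U" by (rule open_off_curve)
  show "?U \<noteq> {}"
  proof
    assume "?U = {}"
    then show False using nc by (simp add: piecewise_constant_on_def)
  qed
  show "\<exists>H'. continuous_on ?U H' \<and> (\<forall>z\<in>?U. (darboux g f \<alpha> has_derivative blinfun_apply (H' z)) (at z))"
  proof (intro exI[of _ H'] conjI ballI)
    show "continuous_on ?U H'"
      unfolding H'_def by (intro continuous_intros) (auto simp: zero_set_def)
    fix z assume "z \<in> ?U"
    then have "eval2 f z \<noteq> 0" by (simp add: zero_set_def)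
    from darboux_has_derivative[OF this, of g \<alpha> UNIV]
    show "(darboux g f \<alpha> has_derivative blinfun_apply (H' z)) (at z)"
      by (rule has_derivative_eq_rhs)
         (simp add: fun_eq_iff H'_def plus_blinfun.rep_eq scaleR_blinfun.rep_eq
           bounded_linear_Blinfun_apply bounded_linear_fst bounded_linear_snd)
  qed
  fix V assume V: "open V \<and> V \<noteq> {} \<and> V \<subseteq> ?U"
  show "\<not> darboux g f \<alpha> constant_on V"
  proof
    assume const: "darboux g f \<alpha> constant_on V"
    have "piecewise_constant_on ?U (darboux g f \<alpha>)"
      by (rule darboux_gradient_zero_imp_piecewise_constant;
          rule darboux_constant_on_open_imp_gradient_zero[of V]) (use V const in auto)
    with nc show False by contradiction
  qed
next
  fix I \<phi> assume I: "is_interval I \<and> solution_on P Q I \<phi> \<and> \<phi> ` I \<subseteq> - zero_set f"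
  have "pdx f * P + pdy f * Q = k * f" using f by (simp add: invariant_curve_def)
  then show "(\<lambda>t. darboux g f \<alpha> (\<phi> t)) constant_on I"
    by (rule darboux_constant_along_solution[OF _ N]) (use I in auto)
qed

section \<open>Transversal sections\<close>

text \<open>
  The line through \<open>p\<close> perpendicular to \<open>u\<close>, which is transversal to the flow at \<open>p\<close> when \<open>u\<close>
  is the velocity there.
\<close>

definition section_point :: "real \<times> real \<Rightarrow> real \<times> real \<Rightarrow> real \<Rightarrow> real \<times> real" where
  "section_point p u s = (fst p + s * (- snd u), snd p + s * fst u)"

lemma section_point_0 [simp]: "section_point p u 0 = p"
  by (simp add: section_point_def)

lemma orthogonal_imp_section_point:
  assumes orth: "inner (w - p) u = 0" and u: "u \<noteq> (0 :: real \<times> real)"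
  obtains s where "w = section_point p u s" "\<bar>s\<bar> * norm u = dist w p"
proof -
  define D where "D = fst u * fst u + snd u * snd u"
  have D: "D > 0" using u unfolding D_def by (cases u) (auto simp: zero_prod_def sum_squares_gt_zero_iff)
  define s where "s = ((snd w - snd p) * fst u - (fst w - fst p) * snd u) / D"
  have o: "(fst w - fst p) * fst u + (snd w - snd p) * snd u = 0"
    using orth by (simp add: inner_prod_def)
  have 1: "s * (- snd u) = fst w - fst p"
  proof -
    have "((snd w - snd p) * fst u - (fst w - fst p) * snd u) * (- snd u) = (fst w - fst p) * D"
      using o unfolding D_def by algebra
    then show ?thesis using D unfolding s_def by (simp add: field_simps)
  qed
  have 2: "s * fst u = snd w - snd p"
  proof -
    have "((snd w - snd p) * fst u - (fst w - fst p) * snd u) * fst u = (snd w - snd p) * D"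
      using o unfolding D_def by algebra
    then show ?thesis using D unfolding s_def by (simp add: field_simps)
  qed
  have w: "w = section_point p u s"
    by (rule prod_eqI) (use 1 2 in \<open>simp_all add: section_point_def\<close>)
  have "w - p = s *\<^sub>R (- snd u, fst u)"
    using 1 2 by (simp add: prod_eq_iff)
  then have "dist w p = \<bar>s\<bar> * norm (- snd u, fst u)" by (simp only: dist_norm norm_scaleR)
  also have "norm (- snd u, fst u) = norm u" by (simp add: norm_prod_def add.commute)
  finally show thesis using w that by simp
qed

text \<open>
  Up to a non-vanishing factor, the derivative of the Darboux function along the section is a
  polynomial in the parameter. If it is identically zero, the function is constant near \<open>p\<close>.
  Otherwise its zeros other than the parameter 0 stay away from 0, and by the mean value theorem
  the function is injective on each of the two half sections near \<open>p\<close>. The disjunction in the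
  conclusion covers both cases.
\<close>

lemma darboux_injective_on_half_sections:
  assumes fp: "eval2 f p \<noteq> 0"
  obtains \<epsilon> where "0 < \<epsilon>"
    "\<And>r s. \<bar>r\<bar> < \<epsilon> \<Longrightarrow> \<bar>s\<bar> < \<epsilon> \<Longrightarrow> 0 < r * s \<Longrightarrow>
       darboux g f \<alpha> (section_point p u r) = darboux g f \<alpha> (section_point p u s) \<Longrightarrow>
       r = s \<or> darboux g f \<alpha> (section_point p u r) = darboux g f \<alpha> p"
proof -
  define \<sigma> where "\<sigma> = section_point p u"
  define h where "h s = darboux g f \<alpha> (\<sigma> s)" for s
  define W where "W = [:[:- snd u:]:] * darboux_dx g f \<alpha> + [:[:fst u:]:] * darboux_dy g f \<alpha>"
  have "continuous_on UNIV (\<lambda>s. eval2 f (\<sigma> s))"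
    unfolding \<sigma>_def section_point_def by (intro continuous_intros)
  then have "((\<lambda>s. eval2 f (\<sigma> s)) \<longlongrightarrow> eval2 f (\<sigma> 0)) (at 0)"
    by (simp add: continuous_on_def)
  then have "eventually (\<lambda>s. eval2 f (\<sigma> s) \<noteq> 0) (at 0)"
    using fp by (intro tendsto_imp_eventually_ne) (auto simp: \<sigma>_def)
  then obtain \<epsilon>1 where \<epsilon>1: "0 < \<epsilon>1" "\<And>s. s \<noteq> 0 \<Longrightarrow> \<bar>s\<bar> < \<epsilon>1 \<Longrightarrow> eval2 f (\<sigma> s) \<noteq> 0"
    unfolding eventually_at by (auto simp: dist_real_def)
  have fnz: "eval2 f (\<sigma> s) \<noteq> 0" if "\<bar>s\<bar> < \<epsilon>1" for s
    using \<epsilon>1(2)[of s] that fp by (cases "s = 0") (auto simp: \<sigma>_def)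
  have h: "(h has_real_derivative \<bar>eval2 f (\<sigma> s)\<bar> powr \<alpha> / eval2 f (\<sigma> s) * eval2 W (\<sigma> s)) (at s)"
    if "\<bar>s\<bar> < \<epsilon>1" for s
  proof -
    have "(\<sigma> has_derivative (\<lambda>x. (x * (- snd u), x * fst u))) (at s)"
      unfolding \<sigma>_def section_point_def[abs_def]
      by (intro has_derivative_Pair) (auto intro!: derivative_eq_intros)
    from has_derivative_compose[OF this darboux_has_derivative[OF fnz[OF that]]]
    show ?thesis
      unfolding has_field_derivative_def h_def[abs_def]
      by (rule has_derivative_eq_rhs) (simp add: fun_eq_iff W_def algebra_simps)
  qed
  have mvt: "\<exists>x. r < x \<and> x < s \<and> eval2 W (\<sigma> x) = 0" if "r < s" "\<bar>r\<bar> < \<epsilon>1" "\<bar>s\<bar> < \<epsilon>1" "h r = h s" for r s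
  proof -
    have small: "\<bar>x\<bar> < \<epsilon>1" if "r \<le> x" "x \<le> s" for x
      using that \<open>\<bar>r\<bar> < \<epsilon>1\<close> \<open>\<bar>s\<bar> < \<epsilon>1\<close> by linarith
    obtain x where x: "r < x" "x < s"
      "h s - h r = (s - r) * (\<bar>eval2 f (\<sigma> x)\<bar> powr \<alpha> / eval2 f (\<sigma> x) * eval2 W (\<sigma> x))"
      using MVT2[OF \<open>r < s\<close> h[OF small]] by blast
    then have "eval2 W (\<sigma> x) = 0"
      using that fnz[OF small[of x]] by simp
    with x show ?thesis by blast
  qed
  show thesis
  proof (cases "\<forall>s. eval2 W (\<sigma> s) = 0")
    case True
    have const: "h s = h 0" if "\<bar>s\<bar> < \<epsilon>1" for s
    proof (rule DERIV_isconst3[where f = h and a = "- \<epsilon>1" and b = \<epsilon>1])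
      show "(h has_real_derivative 0) (at x)" if "x \<in> {- \<epsilon>1<..<\<epsilon>1}" for x
      proof -
        have "\<bar>x\<bar> < \<epsilon>1" using that by (simp add: abs_less_iff)
        from h[OF this] True show ?thesis by simp
      qed
    qed (use that \<epsilon>1(1) in auto)
    show thesis
      by (rule that[OF \<epsilon>1(1)]) (use const in \<open>auto simp: h_def \<sigma>_def\<close>)
  next
    case False
    then obtain r where r: "eval2 W (\<sigma> r) \<noteq> 0" by blast
    have "finite {s. eval2 W (\<sigma> s) = 0}"
      using finite_zeros_on_line[OF r[unfolded \<sigma>_def section_point_def]]
      unfolding \<sigma>_def section_point_def .
    then obtain d where d: "0 < d" "\<And>x. eval2 W (\<sigma> x) = 0 \<Longrightarrow> x \<noteq> 0 \<Longrightarrow> d \<le> \<bar>x\<bar>"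
      using finite_set_avoid[of "{s. eval2 W (\<sigma> s) = 0}" 0] by (auto simp: dist_real_def)
    have inj: "\<not> r < s" if rs: "\<bar>r\<bar> < min \<epsilon>1 d" "\<bar>s\<bar> < min \<epsilon>1 d" "0 < r * s" "h r = h s" for r s
    proof
      assume "r < s"
      then obtain x where x: "r < x" "x < s" "eval2 W (\<sigma> x) = 0"
        using mvt rs by auto
      have "x \<noteq> 0" using x rs(3) by (auto simp: zero_less_mult_iff)
      then have "d \<le> \<bar>x\<bar>" using d(2) x(3) by blast
      then show False using x rs by linarith
    qed
    show thesis
    proof (rule that[of "min \<epsilon>1 d"])
      show "0 < min \<epsilon>1 d" using \<epsilon>1 d by simp
      fix r s :: real assume rs: "\<bar>r\<bar> < min \<epsilon>1 d" "\<bar>s\<bar> < min \<epsilon>1 d" "0 < r * s"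
        "darboux g f \<alpha> (section_point p u r) = darboux g f \<alpha> (section_point p u s)"
      then have "h r = h s" by (simp add: h_def \<sigma>_def)
      then show "r = s \<or> darboux g f \<alpha> (section_point p u r) = darboux g f \<alpha> p"
        using inj[of r s] inj[of s r] rs by (simp add: mult.commute)
    qed
  qed
qed

text \<open>
  The component of \<open>\<phi> t - \<phi> 0\<close> in the direction of the velocity \<open>u\<close> changes sign at every
  multiple of the period. A curve close to \<open>\<phi>\<close> inherits the sign change, so the
  intermediate value theorem makes it cross the section, near \<open>\<phi> 0\<close>.
\<close>

lemma nearby_curves_cross_section:
  assumes sol: "solution_on P Q UNIV \<phi>" and T: "0 < T" and per: "\<And>t. \<phi> (t + T) = \<phi> t"
    and u: "vfield P Q (\<phi> 0) = u" "u \<noteq> 0" and \<epsilon>: "0 < \<epsilon>"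
  obtains e \<delta> where "0 < e" "0 < \<delta>" "\<delta> < T / 2"
    "\<And>\<psi> n. continuous_on {real n * T - \<delta>..real n * T + \<delta>} \<psi> \<Longrightarrow>
       (\<And>t. t \<in> {real n * T - \<delta>..real n * T + \<delta>} \<Longrightarrow> dist (\<psi> t) (\<phi> t) < e) \<Longrightarrow>
       \<exists>t\<in>{real n * T - \<delta>..real n * T + \<delta>}. inner (\<psi> t - \<phi> 0) u = 0 \<and> dist (\<psi> t) (\<phi> 0) < \<epsilon>"
proof -
  define m where "m t = inner (\<phi> t - \<phi> 0) u" for t
  have "(\<phi> has_derivative (\<lambda>h. h *\<^sub>R u)) (at 0)"
    using sol[unfolded solution_on_def has_vector_derivative_def, rule_format, of 0] u(1) by simp
  then have "((\<lambda>t. inner (\<phi> t - \<phi> 0) u) has_derivative (\<lambda>h. inner (h *\<^sub>R u) u)) (at 0)"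
    by (auto intro!: derivative_eq_intros)
  then have "(m has_real_derivative inner u u) (at 0)"
    unfolding m_def[abs_def] has_field_derivative_def
    by (rule has_derivative_eq_rhs) (simp add: fun_eq_iff)
  moreover have "0 < inner u u" using u(2) by simp
  ultimately obtain d1 d2 where d1: "0 < d1" "\<And>h. 0 < h \<Longrightarrow> h < d1 \<Longrightarrow> m 0 < m (0 + h)"
    and d2: "0 < d2" "\<And>h. 0 < h \<Longrightarrow> h < d2 \<Longrightarrow> m (0 - h) < m 0"
    using DERIV_pos_inc_right[of m "inner u u" 0] DERIV_pos_inc_left[of m "inner u u" 0] by metis
  have "continuous_on UNIV \<phi>" using sol by (rule solution_on_continuous)
  then obtain d3 where d3: "0 < d3" "\<And>t. dist t 0 < d3 \<Longrightarrow> dist (\<phi> t) (\<phi> 0) < \<epsilon> / 2"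
    unfolding continuous_on_iff using \<epsilon> by (metis UNIV_I half_gt_zero)
  define \<delta> where "\<delta> = min (min d1 d2) (min d3 (T / 2)) / 2"
  have \<delta>: "0 < \<delta>" "\<delta> < d1" "\<delta> < d2" "\<delta> < d3" "\<delta> < T / 2"
    using d1 d2 d3 T by (auto simp: \<delta>_def min_def)
  have m: "0 < m \<delta>" "m (- \<delta>) < 0"
    using d1(2)[of \<delta>] d2(2)[of \<delta>] \<delta> by (auto simp: m_def)
  define e where "e = min (\<epsilon> / 2) (min (m \<delta>) (- m (- \<delta>)) / norm u)"
  have e: "0 < e" using m \<epsilon> u(2) by (simp add: e_def)
  have e_le: "e * norm u \<le> m \<delta>" "e * norm u \<le> - m (- \<delta>)" "e \<le> \<epsilon> / 2"
  proof -
    have "e \<le> min (m \<delta>) (- m (- \<delta>)) / norm u" by (simp add: e_def)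
    then have "e * norm u \<le> min (m \<delta>) (- m (- \<delta>))" using u(2) by (simp add: pos_le_divide_eq)
    then show "e * norm u \<le> m \<delta>" "e * norm u \<le> - m (- \<delta>)" by auto
    show "e \<le> \<epsilon> / 2" unfolding e_def by (rule min.cobounded1)
  qed
  show thesis
  proof (rule that[OF e \<delta>(1) \<delta>(5)])
    fix \<psi> :: "real \<Rightarrow> real \<times> real" and n :: nat
    let ?a = "real n * T - \<delta>" and ?b = "real n * T + \<delta>"
    assume cont: "continuous_on {?a..?b} \<psi>"
      and near: "\<And>t. t \<in> {?a..?b} \<Longrightarrow> dist (\<psi> t) (\<phi> t) < e"
    have per': "\<phi> (real n * T + s) = \<phi> s" for s
      using periodic_nat[of \<phi> T s n] per by (simp add: add.commute)
    have close: "\<bar>inner (\<psi> t - \<phi> 0) u - inner (\<phi> t - \<phi> 0) u\<bar> < e * norm u" if "t \<in> {?a..?b}" for t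
    proof -
      have "\<bar>inner (\<psi> t - \<phi> 0) u - inner (\<phi> t - \<phi> 0) u\<bar> = \<bar>inner (\<psi> t - \<phi> t) u\<bar>"
        by (simp add: inner_diff_left)
      also have "\<dots> \<le> norm (\<psi> t - \<phi> t) * norm u" by (rule Cauchy_Schwarz_ineq2)
      also have "\<dots> < e * norm u"
        using near[OF that] u(2) by (simp add: dist_norm)
      finally show ?thesis .
    qed
    have "inner (\<psi> ?a - \<phi> 0) u \<le> 0"
      using close[of ?a] e_le \<delta> per'[of "- \<delta>"] by (simp add: m_def)
    have "0 \<le> inner (\<psi> ?b - \<phi> 0) u"
      using close[of ?b] e_le \<delta> per'[of \<delta>] by (simp add: m_def)
    obtain t where t: "?a \<le> t" "t \<le> ?b" "inner (\<psi> t - \<phi> 0) u = 0"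
    proof -
      have "continuous_on {?a..?b} (\<lambda>t. inner (\<psi> t - \<phi> 0) u)"
        using cont by (intro continuous_intros)
      then have "\<exists>t\<ge>?a. t \<le> ?b \<and> inner (\<psi> t - \<phi> 0) u = 0"
        using \<open>inner (\<psi> ?a - \<phi> 0) u \<le> 0\<close> \<open>0 \<le> inner (\<psi> ?b - \<phi> 0) u\<close> \<delta>(1)
        by (intro IVT'[of "\<lambda>t. inner (\<psi> t - \<phi> 0) u" ?a 0 ?b]) auto
      then show thesis using that by blast
    qed
    have "dist (\<phi> t) (\<phi> 0) < \<epsilon> / 2"
      using d3(2)[of "t - real n * T"] per'[of "t - real n * T"] t \<delta> by (simp add: dist_real_def)
    moreover have "dist (\<psi> t) (\<phi> t) < \<epsilon> / 2"
      using near[of t] t e_le(3) by simp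
    ultimately have "dist (\<psi> t) (\<phi> 0) < \<epsilon>"
      using dist_triangle[of "\<psi> t" "\<phi> 0" "\<phi> t"] by linarith
    with t show "\<exists>t\<in>{?a..?b}. inner (\<psi> t - \<phi> 0) u = 0 \<and> dist (\<psi> t) (\<phi> 0) < \<epsilon>"
      by auto
  qed
qed

section \<open>Limit cycles of systems with a Darboux first integral\<close>

text \<open>
  Assume that the orbit is off the curve. Near its point \<open>p\<close> there is a point \<open>z\<close> with \<open>H z \<noteq> H p\<close>,
  and the solution \<open>\<psi>\<close> from \<open>z\<close> follows the orbit for four periods, meeting the section three
  times near \<open>p\<close>. At these hits \<open>H\<close> has the value \<open>H z \<noteq> H p\<close>, so none is at \<open>p\<close>, and two of them are
  on the same half section, where \<open>H\<close>, not being constant, is injective. They coincide, \<open>\<psi>\<close> closes up, and its orbit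
  lies in the given neighbourhood but differs from the limit cycle, as \<open>H\<close> has another value on it.
\<close>

lemma first_integral_limit_cycle_on_curve:
  assumes f: "invariant_curve P Q f k"
    and H: "first_integral P Q (- zero_set f) (darboux g f \<alpha>)"
    and \<Gamma>: "limit_cycle P Q \<Gamma>"
  shows "\<Gamma> \<subseteq> zero_set f"
proof (rule ccontr)
  assume off: "\<not> \<Gamma> \<subseteq> zero_set f"
  let ?H = "darboux g f \<alpha>"
  have nonconst: "\<not> ?H constant_on V" if "open V" "V \<noteq> {}" "V \<subseteq> - zero_set f" for V
    using H that unfolding first_integral_def by blast
  have H_const: "?H (\<psi> s) = ?H (\<psi> t)"
    if "is_interval I" "solution_on P Q I \<psi>" "\<psi> ` I \<subseteq> - zero_set f" "s \<in> I" "t \<in> I" for I \<psi> s t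
  proof -
    have "(\<lambda>t. ?H (\<psi> t)) constant_on I"
      using H that unfolding first_integral_def by blast
    then show ?thesis using that unfolding constant_on_def by metis
  qed
  obtain U where U: "open U" "\<Gamma> \<subseteq> U" "\<And>\<Gamma>'. periodic_orbit P Q \<Gamma>' \<Longrightarrow> \<Gamma>' \<subseteq> U \<Longrightarrow> \<Gamma>' = \<Gamma>"
    using \<Gamma> unfolding limit_cycle_def by metis
  have "periodic_orbit P Q \<Gamma>" using \<Gamma> by (simp add: limit_cycle_def)
  then obtain \<phi> T where sol: "solution_on P Q UNIV \<phi>" and T: "0 < T" and per: "\<And>t. \<phi> (t + T) = \<phi> t"
    and \<Gamma>_eq: "\<Gamma> = range \<phi>" and nz: "\<And>t. vfield P Q (\<phi> t) \<noteq> 0"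
    by (rule periodic_orbitE) blast
  have fnz: "eval2 f (\<phi> t) \<noteq> 0" for t
    using periodic_solution_off_curve[of P Q \<phi> T f k] sol T per f off \<Gamma>_eq by blast
  define p where "p = \<phi> 0"
  define u where "u = vfield P Q p"
  have u: "u \<noteq> 0" using nz by (simp add: u_def p_def)
  have H_\<Gamma>: "?H w = ?H p" if "w \<in> \<Gamma>" for w
    using that H_const[OF _ sol, of _ 0] fnz by (auto simp: \<Gamma>_eq p_def zero_set_def)
  \<comment> \<open>Inside \<open>M\<close> isolation applies, \<open>?H\<close> is differentiable and there are no equilibria.\<close>
  define M where "M = U \<inter> - zero_set f \<inter> - {z. vfield P Q z = 0}"
  have "closed {z. vfield P Q z = 0}"
    unfolding vfield_def by (intro closed_Collect_eq continuous_intros)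
  then have "open M"
    unfolding M_def using U(1) open_off_curve by (intro open_Int) auto
  moreover have "\<Gamma> \<subseteq> M"
    using U(2) fnz nz by (auto simp: M_def \<Gamma>_eq zero_set_def)
  moreover have "compact \<Gamma>"
  proof -
    have "compact (\<phi> ` {0..T})"
      by (intro compact_continuous_image solution_on_continuous[OF solution_on_subset[OF sol]]) auto
    then show ?thesis using periodic_range[of \<phi> T] per T by (simp add: \<Gamma>_eq)
  qed
  ultimately obtain e1 where e1: "0 < e1" "(\<Union>w\<in>\<Gamma>. ball w e1) \<subseteq> M"
    using compact_subset_open_imp_ball_epsilon_subset by metis
  obtain \<epsilon> where \<epsilon>: "0 < \<epsilon>" and half_inj:
    "\<And>r s. \<bar>r\<bar> < \<epsilon> \<Longrightarrow> \<bar>s\<bar> < \<epsilon> \<Longrightarrow> 0 < r * s \<Longrightarrow>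
       ?H (section_point p u r) = ?H (section_point p u s) \<Longrightarrow> r = s \<or> ?H (section_point p u r) = ?H p"
    by (rule darboux_injective_on_half_sections[of f p g \<alpha> u]) (use fnz[of 0] in \<open>auto simp: p_def\<close>)
  have "0 < \<epsilon> * norm u" using \<epsilon>(1) u by simp
  then obtain e2 \<delta> where e2: "0 < e2" and \<delta>: "0 < \<delta>" "\<delta> < T / 2"
    and cross: "\<And>\<psi> n. continuous_on {real n * T - \<delta>..real n * T + \<delta>} \<psi> \<Longrightarrow>
       (\<And>t. t \<in> {real n * T - \<delta>..real n * T + \<delta>} \<Longrightarrow> dist (\<psi> t) (\<phi> t) < e2) \<Longrightarrow>
       \<exists>t\<in>{real n * T - \<delta>..real n * T + \<delta>}. inner (\<psi> t - \<phi> 0) u = 0 \<and> dist (\<psi> t) (\<phi> 0) < \<epsilon> * norm u"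
    using nearby_curves_cross_section[OF sol T per _ u, of "\<epsilon> * norm u"] unfolding u_def p_def by metis
  have "0 < min e1 e2" "0 \<le> 4 * T" using e1 e2 T by auto
  then obtain \<eta> where \<eta>: "0 < \<eta>"
    "\<And>z. dist z (\<phi> 0) < \<eta> \<Longrightarrow> \<exists>\<psi>. \<psi> 0 = z \<and> solution_on P Q {0..4 * T} \<psi> \<and>
       (\<forall>t\<in>{0..4 * T}. dist (\<psi> t) (\<phi> t) < min e1 e2)"
    using continuous_dependence[OF solution_on_subset[OF sol]] by (metis subset_UNIV)
  have "ball p (min \<eta> e1) \<subseteq> - zero_set f"
    using e1(2) unfolding M_def \<Gamma>_eq p_def by (force simp: subset_iff)
  then have "\<not> ?H constant_on ball p (min \<eta> e1)"
    using \<eta>(1) e1(1) by (intro nonconst) auto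
  then obtain z where z: "z \<in> ball p (min \<eta> e1)" "?H z \<noteq> ?H p"
    unfolding constant_on_def by blast
  then obtain \<psi> where \<psi>: "\<psi> 0 = z" "solution_on P Q {0..4 * T} \<psi>"
    and near: "\<And>t. t \<in> {0..4 * T} \<Longrightarrow> dist (\<psi> t) (\<phi> t) < min e1 e2"
    using \<eta>(2)[of z] by (auto simp: p_def dist_commute)
  have \<psi>M: "\<psi> t \<in> M" if "t \<in> {0..4 * T}" for t
  proof -
    have "\<psi> t \<in> ball (\<phi> t) e1" using near[OF that] by (simp add: dist_commute)
    then show ?thesis using e1(2) unfolding \<Gamma>_eq by blast
  qed
  have H\<psi>: "?H (\<psi> t) = ?H z" if "t \<in> {0..4 * T}" for t
  proof -
    have "\<psi> ` {0..4 * T} \<subseteq> - zero_set f" using \<psi>M unfolding M_def by blast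
    then show ?thesis
      using H_const[OF _ \<psi>(2), of t 0] that T \<psi>(1) by (simp add: is_interval_cc)
  qed
  have "\<exists>t s. t \<in> {real n * T - \<delta>..real n * T + \<delta>} \<and> \<psi> t = section_point p u s \<and> \<bar>s\<bar> < \<epsilon>"
    if n: "1 \<le> n" "n \<le> 3" for n
  proof -
    have "1 * T \<le> real n * T" "real n * T \<le> 3 * T"
      using n T by (auto intro!: mult_right_mono)
    then have sub: "{real n * T - \<delta>..real n * T + \<delta>} \<subseteq> {0..4 * T}"
      using \<delta> T by - (rule subsetI, simp only: atLeastAtMost_iff, linarith)
    obtain t where t: "t \<in> {real n * T - \<delta>..real n * T + \<delta>}"
      "inner (\<psi> t - p) u = 0" "dist (\<psi> t) p < \<epsilon> * norm u"
      using cross[of n \<psi>] near sub continuous_on_subset[OF solution_on_continuous[OF \<psi>(2)] sub]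
      unfolding p_def by (metis (no_types, lifting) min_less_iff_conj subsetD)
    obtain s where s: "\<psi> t = section_point p u s" "\<bar>s\<bar> * norm u = dist (\<psi> t) p"
      using orthogonal_imp_section_point[OF t(2) u] by blast
    have "\<bar>s\<bar> < \<epsilon>" using s(2) t(3) u by (metis mult_less_cancel_right norm_ge_zero not_less)
    with t s show ?thesis by blast
  qed
  then obtain \<tau> \<sigma> where hit: "\<And>n. 1 \<le> n \<Longrightarrow> n \<le> (3::nat) \<Longrightarrow>
      \<tau> n \<in> {real n * T - \<delta>..real n * T + \<delta>} \<and> \<psi> (\<tau> n) = section_point p u (\<sigma> n) \<and> \<bar>\<sigma> n\<bar> < \<epsilon>"
    by metis
  have \<tau>: "0 \<le> \<tau> 1" "\<tau> 1 < \<tau> 2" "\<tau> 2 < \<tau> 3" "\<tau> 3 \<le> 4 * T"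
    using hit[of 1] hit[of 2] hit[of 3] \<delta> by auto
  have range: "\<tau> n \<in> {0..4 * T}" if "n \<in> {1, 2, 3}" for n
    using that \<tau> by auto
  have H\<sigma>: "?H (section_point p u (\<sigma> n)) = ?H z" if "n \<in> {1, 2, 3}" for n
    using H\<psi>[OF range[OF that]] hit[of n] that by auto
  have "\<sigma> n \<noteq> 0" if "n \<in> {1, 2, 3}" for n
    using H\<sigma>[OF that] z(2) by auto
  then have "\<sigma> 1 \<noteq> 0" "\<sigma> 2 \<noteq> 0" "\<sigma> 3 \<noteq> 0" by auto
  then have same_side: "0 < \<sigma> 1 * \<sigma> 2 \<or> 0 < \<sigma> 1 * \<sigma> 3 \<or> 0 < \<sigma> 2 * \<sigma> 3"
    by (auto simp: zero_less_mult_iff)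
  have "\<tau> 1 < \<tau> 3" using \<tau> by linarith
  then have "\<exists>i\<in>{1, 2, 3}. \<exists>j\<in>{1, 2, 3}. \<tau> i < \<tau> j \<and> 0 < \<sigma> i * \<sigma> j"
    using same_side \<tau> by auto
  then obtain i j where ij: "i \<in> {1, 2, 3}" "j \<in> {1, 2, 3}" "\<tau> i < \<tau> j" "0 < \<sigma> i * \<sigma> j"
    by blast
  have "\<sigma> i = \<sigma> j"
    using half_inj[of "\<sigma> i" "\<sigma> j"] hit[of i] hit[of j] H\<sigma>[OF ij(1)] H\<sigma>[OF ij(2)] ij z(2) by auto
  then have closed: "\<psi> (\<tau> i) = \<psi> (\<tau> j)"
    using hit[of i] hit[of j] ij by auto
  have sub: "{\<tau> i..\<tau> j} \<subseteq> {0..4 * T}"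
    using range[OF ij(1)] range[OF ij(2)] by auto
  have "periodic_orbit P Q (\<psi> ` {\<tau> i..\<tau> j})"
  proof (rule closed_solution_periodic_orbit[OF solution_on_subset[OF \<psi>(2) sub] ij(3) closed])
    show "vfield P Q (\<psi> (\<tau> i)) \<noteq> 0" using \<psi>M[OF range[OF ij(1)]] by (simp add: M_def)
  qed
  moreover have "\<psi> ` {\<tau> i..\<tau> j} \<subseteq> U" using \<psi>M sub unfolding M_def by blast
  ultimately have "\<psi> ` {\<tau> i..\<tau> j} = \<Gamma>" by (rule U(3))
  then have "\<psi> (\<tau> i) \<in> \<Gamma>" using ij(3) by auto
  then have "?H z = ?H p" using H_\<Gamma> H\<psi>[OF range[OF ij(1)]] by simp
  with z(2) show False by contradiction
qed

theorem theorem2p1: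
  fixes P Q f k :: "real poly poly"
  assumes "invariant_curve P Q f k"
  shows "((\<exists>(\<alpha>::real) (g::real poly poly) h. no_sign_change (N_poly P Q k \<alpha> g) \<and>
             noninvariant_curve P Q h \<and> zero_set (N_poly P Q k \<alpha> g) \<subseteq> zero_set h)
           \<longrightarrow> (\<forall>\<Gamma>. limit_cycle P Q \<Gamma> \<longrightarrow> \<Gamma> \<subseteq> zero_set f)) \<and>
         (\<forall>(\<alpha>::real) (g::real poly poly). N_poly P Q k \<alpha> g = 0 \<and>
             \<not> piecewise_constant_on (- zero_set f) (\<lambda>z. eval2 g z * \<bar>eval2 f z\<bar> powr \<alpha>)
           \<longrightarrow> first_integral P Q (- zero_set f) (\<lambda>z. eval2 g z * \<bar>eval2 f z\<bar> powr \<alpha>) \<and>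
               (\<forall>\<Gamma>. limit_cycle P Q \<Gamma> \<longrightarrow> \<Gamma> \<subseteq> zero_set f))"
proof (intro conjI impI allI; elim exE conjE)
  fix \<Gamma> \<alpha> g h
  assume "limit_cycle P Q \<Gamma>" "no_sign_change (N_poly P Q k \<alpha> g)" "noninvariant_curve P Q h"
    "zero_set (N_poly P Q k \<alpha> g) \<subseteq> zero_set h"
  then show "\<Gamma> \<subseteq> zero_set f"
    using no_periodic_orbit_off_curve[OF assms] unfolding limit_cycle_def by blast
next
  fix \<alpha> g
  assume *: "N_poly P Q k \<alpha> g = 0"
    "\<not> piecewise_constant_on (- zero_set f) (\<lambda>z. eval2 g z * \<bar>eval2 f z\<bar> powr \<alpha>)"
  note first = darboux_first_integral[OF assms, of \<alpha> g, unfolded darboux_def[abs_def], OF *]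
  show "first_integral P Q (- zero_set f) (\<lambda>z. eval2 g z * \<bar>eval2 f z\<bar> powr \<alpha>)"
    by (rule first)
  fix \<Gamma> assume "limit_cycle P Q \<Gamma>"
  then show "\<Gamma> \<subseteq> zero_set f"
    using first_integral_limit_cycle_on_curve[OF assms, of g \<alpha>, unfolded darboux_def[abs_def], OF first]
    by blast
qed

end
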